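(* Suppose $s=\sigma+it$ with $\frac12<\sigma<1$, $t\in\mathbb{R}$. Let $p>2$, suppose $\kappa=(k_n)_{n\ge1}$ is an $L^p$-good universal sequence of natural numbers, and let $$R_N(s,x,\kappa):=\frac1N\sum_{n=1}^{N}\zeta(s+iT^{k_n}x)\qquad(N=1,2,\ldots).$$ Then: (i) there exists a constant $C>0$ such that $$\sum_{N=1}^{\infty}\bigl\|R_{N+1}(s,\cdot,\kappa)-R_N(s,\cdot,\kappa)\bigr\|_2^2\le\frac{C}{\pi\sigma}\left|\frac{\zeta(2\sigma)}{2}+\frac{\zeta(2\sigma-1)}{2\sigma-1}\right|;$$ (ii) for $\alpha>0$ and $\beta\in\mathbb{R}$ there exists $C>0$ such that for all $\lambda>0$ $$\mu_{\alpha,\beta}\left(\left\{x:\sum_{N=1}^{\infty}|R_{N+1}(s,x,\kappa)-R_N(s,x,\kappa)|^2\ge\lambda\right\}\right)\le\frac{C}{\lambda^2}\left|\frac{\zeta(2\sigma)}{2}+\frac{\zeta(2\sigma-1)}{2\sigma-1}\right|.$$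
   Context: $\zeta$ is the Riemann zeta function. $T:\mathbb{R}\to\mathbb{R}$ is the map $T(x)=\frac12\left(x-\frac1x\right)$ for $x\neq0$, $T(0)=0$, and $T^n$ is its $n$-th iterate. For $\alpha>0$, $\beta\in\mathbb{R}$, $\mu_{\alpha,\beta}(A)=\frac{\alpha}{\pi}\int_A\frac{dt}{\alpha^2+(t-\beta)^2}$ for Lebesgue measurable $A\subseteq\mathbb{R}$; $T$ preserves and is ergodic for $\mu=\mu_{1,0}$. $\|\cdot\|_2$ is the norm of $L^2(\mathbb{R},\mu)$ in the variable $x$. A dynamical system $(X,\mathcal{A},\mu,T)$ is a probability space together with a measurable, measure preserving map. A sequence of natural numbers $(k_n)_{n\ge1}$ is $L^p$-good universal if for every dynamical system $(X,\mathcal{A},\mu,T)$ and every $g\in L^p(X,\mathcal{A},\mu)$ the limit $\lim_{N\to\infty}\frac1N\sum_{n=1}^{N}g(T^{k_n}x)$ exists for $\mu$-almost every $x$. *)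

theory Defs
  imports
    "HOL-Complex_Analysis.Complex_Analysis"
    "HOL-Probability.Probability"
begin

section \<open>The Riemann zeta function\<close>

definition is_zeta :: "(complex \<Rightarrow> complex) \<Rightarrow> bool" where
  "is_zeta f \<longleftrightarrow>
     f holomorphic_on (- {1}) \<and>
     (\<forall>s. Re s > 1 \<longrightarrow> (\<lambda>n. 1 / of_nat (Suc n) powr s) sums f s)"

text \<open>
  The analytic continuation of the Dirichlet series to the punctured plane.  It exists and is
  unique away from the pole (lemmas \<open>is_zeta_riemann_zeta\<close> and \<open>is_zeta_unique\<close> below); the value
  at the pole \<open>1\<close> is an unspecified junk value.
\<close>
definition riemann_zeta :: "complex \<Rightarrow> complex" where
  "riemann_zeta = (SOME f. is_zeta f)"

lemma is_zeta_unique: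
  assumes "is_zeta f" "is_zeta g" "s \<noteq> 1"
  shows "f s = g s"
proof (rule analytic_continuation_open[where f = f and g = g and z = s
      and s = "{s. Re s > 1}" and s' = "- {1}"])
  show "open {s. Re s > 1}" by (rule open_halfspace_Re_gt)
  have "(2::complex) \<in> {s. Re s > 1}" by simp
  then show "{s. Re s > 1} \<noteq> {}" by blast
  show "connected (- {1::complex})"
    by (rule connected_punctured_universe) simp
  show "f z = g z" if "z \<in> {s. Re s > 1}" for z
    using that assms(1,2) by (auto simp: is_zeta_def intro: sums_unique2)
qed (use assms in \<open>auto simp: is_zeta_def\<close>)

lemma half_plane_series:
  fixes a :: "nat \<Rightarrow> complex \<Rightarrow> complex" and B :: "complex \<Rightarrow> real" and c :: real
  assumes hol: "\<And>n. a n holomorphic_on {s. Re s > c}"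
    and B: "continuous_on UNIV B"
    and le: "\<And>n s. Re s > c \<Longrightarrow> norm (a n s) \<le> B s * real (Suc n) powr (c - Re s - 1)"
  shows "\<exists>g. g holomorphic_on {s. Re s > c} \<and> (\<forall>s. Re s > c \<longrightarrow> (\<lambda>n. a n s) sums g s)"
proof -
  let ?S = "{s. Re s > c}"
  have S: "open ?S" by (rule open_halfspace_Re_gt)
  have "\<exists>g g'. \<forall>x\<in>?S. ((\<lambda>n. a n x) sums g x) \<and> ((\<lambda>n. deriv (a n) x) sums g' x)
          \<and> (g has_field_derivative g' x) (at x)"
  proof (rule series_and_derivative_comparison_local[OF S])
    show "(a n has_field_derivative deriv (a n) x) (at x)" if "x \<in> ?S" for n x
      using holomorphic_derivI[OF hol S that] .
  next
    fix x assume x: "x \<in> ?S"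
    define d where "d = (Re x - c) / 2"
    have d: "d > 0" using x by (simp add: d_def)
    have "bounded (B ` cball x d)"
      by (intro compact_imp_bounded compact_continuous_image continuous_on_subset[OF B]) auto
    then obtain M where M: "\<And>y. y \<in> cball x d \<Longrightarrow> norm (B y) \<le> M"
      unfolding bounded_iff by blast
    have M0: "M \<ge> 0" using M[of x] d by (smt (verit) centre_in_cball norm_ge_zero)
    have "summable (\<lambda>n. real n powr (- d - 1))"
      using d by (subst summable_real_powr_iff) auto
    then have sm: "summable (\<lambda>n. M * real (Suc n) powr (- d - 1))"
      by (intro summable_mult) (subst summable_Suc_iff, assumption)
    have "norm (a n y) \<le> M * real (Suc n) powr (- d - 1)" if y: "y \<in> ball x d \<inter> ?S" for n y
    proof -
      have "Re x - Re y \<le> d"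
        using y complex_Re_le_cmod[of "x - y"] by (simp add: dist_norm)
      then have ex: "c - Re y - 1 \<le> - d - 1" by (simp add: d_def field_simps)
      have "norm (a n y) \<le> B y * real (Suc n) powr (c - Re y - 1)" using y by (intro le) auto
      also have "\<dots> \<le> M * real (Suc n) powr (c - Re y - 1)"
        using M[of y] y by (intro mult_right_mono) auto
      also have "\<dots> \<le> M * real (Suc n) powr (- d - 1)"
        using M0 ex by (intro mult_left_mono powr_mono) auto
      finally show ?thesis .
    qed
    then show "\<exists>d h. 0 < d \<and> summable h \<and>
        (\<forall>\<^sub>F n in sequentially. \<forall>y\<in>ball x d \<inter> ?S. norm (a n y) \<le> h n)"
      using d sm by (intro exI[of _ d] exI[of _ "\<lambda>n. M * real (Suc n) powr (- d - 1)"]) auto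
  qed
  then obtain g g' where g: "\<forall>x\<in>?S. ((\<lambda>n. a n x) sums g x) \<and> (g has_field_derivative g' x) (at x)"
    by blast
  then have "g holomorphic_on ?S"
    using holomorphic_on_open[OF S] by blast
  with g show ?thesis by auto
qed

lemma half_plane_dirichlet_series:
  "\<exists>Z. Z holomorphic_on {s. Re s > 1} \<and>
     (\<forall>s. Re s > 1 \<longrightarrow> (\<lambda>n. 1 / of_nat (Suc n) powr s) sums Z s)"
proof (rule half_plane_series[where B = "\<lambda>_. 1"])
  fix n :: nat
  have "(of_nat (Suc n) :: complex) \<noteq> 0" by (simp del: of_nat_Suc)
  then show "(\<lambda>s. 1 / of_nat (Suc n) powr s) holomorphic_on {s. Re s > 1}"
    by (intro holomorphic_intros) auto
next
  fix n :: nat and s :: complex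
  have "norm (complex_of_real (real (Suc n)) powr s) = real (Suc n) powr Re s"
    by (subst norm_powr_real_powr) (auto simp del: of_nat_Suc)
  then show "norm (1 / of_nat (Suc n) powr s) \<le> 1 * real (Suc n) powr (1 - Re s - 1)"
    by (simp add: norm_divide powr_minus divide_simps del: of_nat_Suc)
qed auto

text \<open>
  Taylor expansion of \<open>(n + 2) powr (1 - s)\<close> around \<open>n + 1\<close> to order \<open>m + 1\<close>, with a remainder
  that is summable over \<open>n\<close> for \<open>Re s > - m\<close>.
\<close>
lemma powr_taylor_bound:
  fixes s :: complex and n m :: nat
  defines "P \<equiv> \<lambda>i s. \<Prod>j<i. (1 - s - of_nat j :: complex)"
  assumes s: "Re s > - real m"
  shows "norm (of_nat (Suc (Suc n)) powr (1 - s)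
           - (\<Sum>i\<le>Suc m. P i s / fact i * of_nat (Suc n) powr (1 - s - of_nat i)))
         \<le> norm (P (Suc (Suc m)) s) / fact (Suc m) * real (Suc n) powr (- real m - Re s - 1)"
proof -
  define f where "f = (\<lambda>i x. P i s * x powr (1 - s - of_nat i))"
  define S where "S = closed_segment (of_nat (Suc n) :: complex) (of_nat (Suc (Suc n)))"
  have S: "\<exists>r\<ge>real (Suc n). x = complex_of_real r" if "x \<in> S" for x
  proof -
    have "x \<in> closed_segment (complex_of_real (real (Suc n))) (complex_of_real (real (Suc (Suc n))))"
      using that by (simp only: S_def of_real_of_nat_eq)
    then have "x \<in> complex_of_real ` closed_segment (real (Suc n)) (real (Suc (Suc n)))"
      by (simp only: closed_segment_of_real)
    then show ?thesis by (auto simp: closed_segment_eq_real_ivl)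
  qed
  have bound: "norm (f 0 (of_nat (Suc (Suc n)))
          - (\<Sum>i\<le>Suc m. f i (of_nat (Suc n)) * (of_nat (Suc (Suc n)) - of_nat (Suc n)) ^ i / fact i))
      \<le> norm (P (Suc (Suc m)) s) * real (Suc n) powr (- real m - Re s - 1)
          * norm (of_nat (Suc (Suc n)) - of_nat (Suc n) :: complex) ^ (Suc (Suc m)) / fact (Suc m)"
  proof (rule complex_Taylor[where S = S])
    fix i x assume x: "x \<in> S"
    then obtain r where r: "r \<ge> real (Suc n)" "x = of_real r" using S by blast
    then have nz: "x \<notin> \<real>\<^sub>\<le>\<^sub>0" by auto
    have "((\<lambda>x. P i s * x powr (1 - s - of_nat i)) has_field_derivative
            P i s * ((1 - s - of_nat i) * x powr (1 - s - of_nat i - 1))) (at x)"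
      by (intro DERIV_cmult has_field_derivative_powr nz)
    also have "P i s * ((1 - s - of_nat i) * x powr (1 - s - of_nat i - 1)) = f (Suc i) x"
      by (simp add: f_def P_def algebra_simps)
    finally show "(f i has_field_derivative f (Suc i) x) (at x within S)"
      unfolding f_def by (rule DERIV_subset) auto
  next
    fix x assume x: "x \<in> S"
    then obtain r where r: "r \<ge> real (Suc n)" "x = of_real r" using S by blast
    then have "norm (x powr (1 - s - of_nat (Suc (Suc m)))) = r powr (- real m - Re s - 1)"
      by (subst norm_powr_real_powr) (auto intro!: arg_cong[where f = "\<lambda>e. r powr e"])
    also have "\<dots> \<le> real (Suc n) powr (- real m - Re s - 1)"
      using r s by (intro powr_mono2') auto
    finally show "norm (f (Suc (Suc m)) x)
        \<le> norm (P (Suc (Suc m)) s) * real (Suc n) powr (- real m - Re s - 1)"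
      by (simp add: f_def norm_mult mult_left_mono del: of_nat_Suc)
  qed (auto simp: S_def)
  have f0: "f 0 z = z powr (1 - s)" for z by (simp add: f_def P_def)
  have diff: "of_nat (Suc (Suc n)) - of_nat (Suc n) = (1 :: complex)" by simp
  show ?thesis
    using bound unfolding f0 diff by (simp add: f_def del: of_nat_Suc fact_Suc sum.atMost_Suc)
qed

lemma tendsto_powr_neg: "(\<lambda>n. of_nat (Suc n) powr (1 - s)) \<longlonglongrightarrow> (0::complex)" if "Re s > 1"
proof (rule tendsto_norm_zero_cancel)
  have "(\<lambda>n. real n powr (1 - Re s)) \<longlonglongrightarrow> 0"
    using that by real_asymp
  then have "(\<lambda>n. real (Suc n) powr (1 - Re s)) \<longlonglongrightarrow> 0"
    by (rule LIMSEQ_Suc)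
  moreover have "norm (of_nat (Suc n) powr (1 - s) :: complex) = real (Suc n) powr (1 - Re s)" for n
    using norm_powr_real_powr[of "complex_of_real (real (Suc n))" "1 - s"]
    by (simp del: of_nat_Suc)
  ultimately show "(\<lambda>n. norm (of_nat (Suc n) powr (1 - s) :: complex)) \<longlonglongrightarrow> 0"
    by simp
qed

lemma zeta_half_plane_extension:
  fixes Z :: "complex \<Rightarrow> complex"
  assumes Zhol: "Z holomorphic_on {s. Re s > 1}"
    and Z: "\<And>s. Re s > 1 \<Longrightarrow> (\<lambda>n. 1 / of_nat (Suc n) powr s) sums Z s"
  shows "\<exists>g. g holomorphic_on {s. Re s > 1 - real m} \<and> (\<forall>s. Re s > 1 \<longrightarrow> g s = (s - 1) * Z s)"
proof (induction m)
  case 0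
  show ?case by (intro exI[of _ "\<lambda>s. (s - 1) * Z s"]) (auto intro!: holomorphic_intros Zhol)
next
  case (Suc m)
  then obtain g where ghol: "g holomorphic_on {s. Re s > 1 - real m}"
    and g: "\<And>s. Re s > 1 \<Longrightarrow> g s = (s - 1) * Z s" by blast
  define P where "P = (\<lambda>i s. \<Prod>j<i. (1 - s - of_nat j :: complex))"
  define r where "r = (\<lambda>n s. of_nat (Suc (Suc n)) powr (1 - s)
           - (\<Sum>i\<le>Suc m. P i s / fact i * of_nat (Suc n) powr (1 - s - of_nat i)))"
  have Phol: "P i holomorphic_on A" for i A
    unfolding P_def by (intro holomorphic_intros)
  have "\<exists>R. R holomorphic_on {s. Re s > - real m} \<and> (\<forall>s. Re s > - real m \<longrightarrow> (\<lambda>n. r n s) sums R s)"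
  proof (rule half_plane_series[where B = "\<lambda>s. norm (P (Suc (Suc m)) s) / fact (Suc m)"])
    fix n
    have nz: "(of_nat (Suc n) :: complex) \<noteq> 0" for n by (simp del: of_nat_Suc)
    show "r n holomorphic_on {s. Re s > - real m}"
      unfolding r_def by (intro holomorphic_intros Phol) (auto simp del: of_nat_Suc simp: nz)
  next
    show "continuous_on UNIV (\<lambda>s. norm (P (Suc (Suc m)) s) / fact (Suc m))"
      by (intro continuous_intros holomorphic_on_imp_continuous_on Phol) auto
  next
    fix n s assume "Re s > - real m"
    then show "norm (r n s) \<le> norm (P (Suc (Suc m)) s) / fact (Suc m)
                 * real (Suc n) powr (- real m - Re s - 1)"
      unfolding r_def P_def by (rule powr_taylor_bound)
  qed
  then obtain R where Rhol: "R holomorphic_on {s. Re s > - real m}"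
    and R: "\<And>s. Re s > - real m \<Longrightarrow> (\<lambda>n. r n s) sums R s" by blast
  define h where "h = (\<lambda>s. 1 + R s - (\<Sum>j<m. P (Suc j) s / fact (Suc (Suc j)) * g (s + of_nat (Suc j))))"
  have "h holomorphic_on {s. Re s > - real m}"
    unfolding h_def
  proof (intro holomorphic_intros Phol Rhol)
    fix j
    have "g \<circ> (\<lambda>s. s + of_nat (Suc j)) holomorphic_on {s. Re s > - real m}"
      by (rule holomorphic_on_compose_gen[OF _ ghol]) (auto intro!: holomorphic_intros)
    then show "(\<lambda>s. g (s + of_nat (Suc j))) holomorphic_on {s. Re s > - real m}"
      by (simp add: o_def)
  qed (auto simp del: fact_Suc)
  moreover have "h s = (s - 1) * Z s" if s: "Re s > 1" for s
  proof -
    have t: "(\<lambda>n. of_nat (Suc (Suc n)) powr (1 - s) - of_nat (Suc n) powr (1 - s)) sums (0 - 1 :: complex)"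
      using telescope_sums[OF tendsto_powr_neg[OF s]] by simp
    have e: "(\<lambda>n. P i s / fact i * of_nat (Suc n) powr (1 - s - of_nat i))
               sums (P i s / fact i * Z (s + of_nat i - 1))" if "i \<ge> 1" for i
    proof -
      have "(1 / of_nat (Suc n) powr (s + of_nat i - 1) :: complex)
              = of_nat (Suc n) powr (1 - s - of_nat i)" for n
        by (simp add: powr_minus[symmetric] inverse_eq_divide[symmetric] algebra_simps del: of_nat_Suc)
      moreover have "Re (s + of_nat i - 1) > 1" using s that by simp
      ultimately show ?thesis using Z[of "s + of_nat i - 1"] by (intro sums_mult) simp
    qed
    have "(\<lambda>n. (of_nat (Suc (Suc n)) powr (1 - s) - of_nat (Suc n) powr (1 - s))
              - (\<Sum>i\<in>{1..Suc m}. P i s / fact i * of_nat (Suc n) powr (1 - s - of_nat i)))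
            sums ((0 - 1) - (\<Sum>i\<in>{1..Suc m}. P i s / fact i * Z (s + of_nat i - 1)))"
      by (intro sums_diff t sums_sum e) auto
    also have "(\<lambda>n. (of_nat (Suc (Suc n)) powr (1 - s) - of_nat (Suc n) powr (1 - s))
              - (\<Sum>i\<in>{1..Suc m}. P i s / fact i * of_nat (Suc n) powr (1 - s - of_nat i))) = (\<lambda>n. r n s)"
    proof
      fix n
      have "{..Suc m} = insert 0 {1..Suc m}" by auto
      then show "(of_nat (Suc (Suc n)) powr (1 - s) - of_nat (Suc n) powr (1 - s))
              - (\<Sum>i\<in>{1..Suc m}. P i s / fact i * of_nat (Suc n) powr (1 - s - of_nat i)) = r n s"
        by (simp add: r_def P_def del: of_nat_Suc sum.cl_ivl_Suc)
    qed
    finally have "R s = - 1 - (\<Sum>i\<in>{1..Suc m}. P i s / fact i * Z (s + of_nat i - 1))"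
      using sums_unique2[OF R[of s]] s by simp
    also have "{1..Suc m} = Suc ` {..<Suc m}"
      by (simp add: image_Suc_lessThan)
    also have "(\<Sum>i\<in>Suc ` {..<Suc m}. P i s / fact i * Z (s + of_nat i - 1))
        = (\<Sum>i<Suc m. P (Suc i) s / fact (Suc i) * Z (s + of_nat i))"
      by (subst sum.reindex) (auto simp: o_def add_ac)
    also have "\<dots> = (1 - s) * Z s
        + (\<Sum>j<m. P (Suc (Suc j)) s / fact (Suc (Suc j)) * Z (s + of_nat (Suc j)))"
      by (subst sum.lessThan_Suc_shift) (simp add: P_def)
    also have "(\<Sum>j<m. P (Suc (Suc j)) s / fact (Suc (Suc j)) * Z (s + of_nat (Suc j)))
        = (\<Sum>j<m. - (P (Suc j) s / fact (Suc (Suc j)) * g (s + of_nat (Suc j))))"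
    proof (rule sum.cong)
      fix j
      have "P (Suc (Suc j)) s = - (P (Suc j) s * (s + of_nat (Suc j) - 1))"
        by (simp add: P_def algebra_simps)
      moreover have "g (s + of_nat (Suc j)) = (s + of_nat (Suc j) - 1) * Z (s + of_nat (Suc j))"
        using s by (intro g) simp
      ultimately show "P (Suc (Suc j)) s / fact (Suc (Suc j)) * Z (s + of_nat (Suc j))
        = - (P (Suc j) s / fact (Suc (Suc j)) * g (s + of_nat (Suc j)))"
        by (simp only: times_divide_eq_left mult_minus_left minus_divide_left mult.assoc)
    qed simp
    finally show ?thesis by (simp add: h_def sum_negf algebra_simps)
  qed
  ultimately show ?case by (intro exI[of _ h]) simp
qed

lemma is_zeta_exists: "\<exists>f. is_zeta f"
proof -
  obtain Z where Zhol: "Z holomorphic_on {s. Re s > 1}"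
    and Z: "\<And>s. Re s > 1 \<Longrightarrow> (\<lambda>n. 1 / of_nat (Suc n) powr s) sums Z s"
    using half_plane_dirichlet_series by blast
  obtain G where Ghol: "\<And>m. G m holomorphic_on {s. Re s > 1 - real m}"
    and G: "\<And>m s. Re s > 1 \<Longrightarrow> G m s = (s - 1) * Z s"
    using zeta_half_plane_extension[OF Zhol Z] by metis
  have agree: "G k s = G m s" if "Re s > 1 - real k" "k \<le> m" for k m s
  proof (rule analytic_continuation_open[where f = "G k" and g = "G m" and z = s
      and s = "{s. Re s > 1}" and s' = "{s. Re s > 1 - real k}"])
    have "(2::complex) \<in> {s. Re s > 1}" by simp
    then show "{s. Re s > 1} \<noteq> {}" by blast
    show "connected {s. Re s > 1 - real k}"
      by (intro convex_connected convex_halfspace_Re_gt)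
    show "G m holomorphic_on {s. Re s > 1 - real k}"
      by (rule holomorphic_on_subset[OF Ghol]) (use that in auto)
  qed (use that G Ghol in \<open>auto simp: open_halfspace_Re_gt\<close>)
  have agree': "G k s = G m s" if "Re s > 1 - real k" "Re s > 1 - real m" for k m s
    using agree[OF that(1), of m] agree[OF that(2), of k] nat_le_linear[of k m] by metis
  define N where "N = (\<lambda>s. nat \<lceil>1 - Re s\<rceil> + 1)"
  have N: "Re s > 1 - real (N s)" for s unfolding N_def by linarith
  define F where "F = (\<lambda>s. G (N s) s)"
  have "F holomorphic_on (\<Union>m\<in>UNIV. {s. Re s > 1 - real m})"
  proof (rule holomorphic_on_UN_open)
    fix m
    show "F holomorphic_on {s. Re s > 1 - real m}"
    proof (rule holomorphic_transform[OF Ghol[of m]])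
      fix x assume "x \<in> {s. Re s > 1 - real m}"
      then show "G m x = F x" unfolding F_def using N[of x] by (intro agree') simp_all
    qed
  qed (auto simp: open_halfspace_Re_gt)
  moreover have "(\<Union>m\<in>UNIV. {s. Re s > 1 - real m}) = (UNIV :: complex set)"
    using N by blast
  ultimately have Fhol: "F holomorphic_on UNIV" by simp
  have "is_zeta (\<lambda>s. F s / (s - 1))"
    unfolding is_zeta_def
  proof (intro conjI allI impI)
    show "(\<lambda>s. F s / (s - 1)) holomorphic_on - {1}"
      by (intro holomorphic_intros holomorphic_on_subset[OF Fhol]) auto
    fix s :: complex assume s: "Re s > 1"
    then have "s \<noteq> 1" by auto
    then have "F s / (s - 1) = Z s" using G[OF s] by (simp add: F_def)
    with Z[OF s] show "(\<lambda>n. 1 / of_nat (Suc n) powr s) sums (F s / (s - 1))" by simp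
  qed
  then show ?thesis by blast
qed

lemma is_zeta_riemann_zeta: "is_zeta riemann_zeta"
  unfolding riemann_zeta_def using is_zeta_exists by (rule someI_ex)


section \<open>Good universal sequences\<close>

definition dynamical_system :: "'a measure \<Rightarrow> ('a \<Rightarrow> 'a) \<Rightarrow> bool" where
  "dynamical_system M T \<longleftrightarrow> prob_space M \<and> T \<in> measurable M M \<and> distr M M T = M"

definition Lp_space :: "real \<Rightarrow> 'a measure \<Rightarrow> ('a \<Rightarrow> complex) set" where
  "Lp_space p M = {g \<in> borel_measurable M. integrable M (\<lambda>x. norm (g x) powr p)}"

text \<open>
  HOL cannot quantify over the underlying type of the system inside a formula, so the definition
  ranges over all dynamical systems carried by (subsets of) the type \<^typ>\<open>nat \<Rightarrow> complex\<close>.  No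
  generality is lost: by lemma \<open>Lp_good_universal_any_system\<close> below the defining property then holds
  for dynamical systems over every type.  Only the values \<open>k n\<close> with \<open>n \<ge> 1\<close> matter.
\<close>
definition Lp_good_universal :: "real \<Rightarrow> (nat \<Rightarrow> nat) \<Rightarrow> bool" where
  "Lp_good_universal p k \<longleftrightarrow>
     (\<forall>(M :: (nat \<Rightarrow> complex) measure) T. dynamical_system M T \<longrightarrow>
        (\<forall>g \<in> Lp_space p M.
           AE x in M. convergent (\<lambda>N. (\<Sum>n = 1..N. g ((T ^^ k n) x)) / of_nat N)))"

lemma Lp_good_universal_any_system:
  fixes M :: "'a measure"
  assumes k: "Lp_good_universal p k" and sys: "dynamical_system M T" and g: "g \<in> Lp_space p M"
  shows "AE x in M. convergent (\<lambda>N. (\<Sum>n = 1..N. g ((T ^^ k n) x)) / of_nat N)"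
proof -
  interpret prob_space M using sys by (simp add: dynamical_system_def)
  have T[measurable]: "T \<in> measurable M M" and inv: "distr M M T = M"
    using sys by (auto simp: dynamical_system_def)
  have gm[measurable]: "g \<in> borel_measurable M" and gi: "integrable M (\<lambda>x. norm (g x) powr p)"
    using g by (auto simp: Lp_space_def)
  define Q where "Q = PiM (UNIV :: nat set) (\<lambda>_. borel :: complex measure)"
  define F where "F = (\<lambda>x n. g ((T ^^ n) x))"
  define S where "S = (\<lambda>(w :: nat \<Rightarrow> complex) n. w (Suc n))"
  define N where "N = distr M Q F"
  have F[measurable]: "F \<in> measurable M Q"
    unfolding F_def Q_def by (rule measurable_PiM_single') (auto simp: space_PiM)
  have comp: "(\<lambda>w. w n) \<in> borel_measurable Q" for n
    unfolding Q_def by (rule measurable_component_singleton) simp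
  have S[measurable]: "S \<in> measurable Q Q"
    unfolding S_def using comp unfolding Q_def
    by (intro measurable_PiM_single') (auto simp: space_PiM)
  have SF: "S (F x) = F (T x)" for x
    by (simp add: S_def F_def funpow_swap1)
  have "distr N N S = distr N Q S"
    by (rule distr_cong) (auto simp: N_def)
  also have "\<dots> = distr M Q (\<lambda>x. F (T x))"
    unfolding N_def by (subst distr_distr) (auto simp: o_def SF)
  also have "\<dots> = distr (distr M M T) Q F"
    by (subst distr_distr) (auto simp: o_def)
  also have "\<dots> = N" by (simp add: inv N_def)
  finally have "distr N N S = N" .
  moreover have "prob_space N" unfolding N_def by (rule prob_space_distr) simp
  moreover have "S \<in> measurable N N" by (simp add: N_def)
  ultimately have "dynamical_system N S" by (simp add: dynamical_system_def)
  moreover have "(\<lambda>w. w 0) \<in> Lp_space p N"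
  proof -
    have [measurable]: "(\<lambda>w. w 0) \<in> borel_measurable Q" by (rule comp)
    show ?thesis
      unfolding Lp_space_def N_def using gi
      by (subst mem_Collect_eq, subst integrable_distr_eq[OF F]) (simp_all add: F_def)
  qed
  ultimately have AEN: "AE w in N. convergent (\<lambda>n. (\<Sum>i = 1..n. ((S ^^ k i) w) 0) / of_nat n)"
    by (rule k[unfolded Lp_good_universal_def, rule_format])
  have Sn: "(S ^^ n) w = (\<lambda>i. w (i + n))" for n w
    by (induction n) (auto simp: S_def)
  have "AE w in distr M Q F. convergent (\<lambda>n. (\<Sum>i = 1..n. w (k i)) / of_nat n)"
    using AEN unfolding N_def Sn by simp
  then have "AE x in M. convergent (\<lambda>n. (\<Sum>i = 1..n. F x (k i)) / of_nat n)"
    by (rule AE_distrD[OF F])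
  then show ?thesis by (simp add: F_def)
qed


section \<open>Boole's map and the Cauchy measures\<close>

definition boole_map :: "real \<Rightarrow> real" where
  "boole_map x = (if x = 0 then 0 else (x - 1 / x) / 2)"

definition cauchy_measure :: "real \<Rightarrow> real \<Rightarrow> real measure" where
  "cauchy_measure \<alpha> \<beta> = density lebesgue (\<lambda>t. ennreal (\<alpha> / pi * (1 / (\<alpha>\<^sup>2 + (t - \<beta>)\<^sup>2))))"

text \<open>The \<open>L\<^sup>2\<close> norm as an extended real: it is \<open>\<infinity>\<close> unless \<open>f\<close> is square integrable.\<close>
definition L2_norm :: "'a measure \<Rightarrow> ('a \<Rightarrow> complex) \<Rightarrow> ennreal" where
  "L2_norm M f =
     (let I = (\<integral>\<^sup>+x. ennreal ((norm (f x))\<^sup>2) \<partial>M)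
      in if I = \<infinity> then \<infinity> else ennreal (sqrt (enn2real I)))"

lemma L2_norm_power2: "(L2_norm M f)\<^sup>2 = (\<integral>\<^sup>+x. ennreal ((norm (f x))\<^sup>2) \<partial>M)"
  by (auto simp: L2_norm_def Let_def ennreal_power top_power_ennreal less_top)

definition zeta_avg :: "(nat \<Rightarrow> nat) \<Rightarrow> complex \<Rightarrow> nat \<Rightarrow> real \<Rightarrow> complex" where
  "zeta_avg k s N x =
     (\<Sum>n = 1..N. riemann_zeta (s + \<i> * complex_of_real ((boole_map ^^ k n) x))) / of_nat N"

text \<open>
  Hence the integrands and level sets built from \<open>zeta_avg\<close> are measurable, so that neither
  \<^const>\<open>nn_integral\<close> nor \<^const>\<open>emeasure\<close> is applied outside its intended domain.
\<close>
lemma zeta_avg_measurable: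
  assumes "Re s \<noteq> 1"
  shows "zeta_avg k s N \<in> borel_measurable (cauchy_measure \<alpha> \<beta>)"
proof -
  have [measurable]: "boole_map \<in> borel_measurable borel"
    unfolding boole_map_def by measurable
  have iter[measurable]: "(boole_map ^^ n) \<in> borel_measurable borel" for n
    by (induction n) (auto simp: o_def)
  have cont: "continuous_on (- {1}) riemann_zeta"
    using is_zeta_riemann_zeta by (auto simp: is_zeta_def intro: holomorphic_on_imp_continuous_on)
  have "s + \<i> * complex_of_real x \<in> - {1}" for x
    using assms by (auto simp: complex_eq_iff)
  then have "range (\<lambda>x. s + \<i> * complex_of_real x) \<subseteq> - {1}"
    by (rule image_subsetI)
  moreover have "continuous_on UNIV (\<lambda>x. s + \<i> * complex_of_real x)"
    by (intro continuous_intros)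
  ultimately have "continuous_on UNIV (\<lambda>x. riemann_zeta (s + \<i> * complex_of_real x))"
    by (intro continuous_on_compose2[OF cont])
  then have [measurable]: "(\<lambda>x. riemann_zeta (s + \<i> * complex_of_real x)) \<in> borel_measurable borel"
    by (rule borel_measurable_continuous_onI)
  have [measurable]: "(\<lambda>x. riemann_zeta (s + \<i> * complex_of_real ((boole_map ^^ n) x))) \<in> borel_measurable borel" for n
    by (rule measurable_compose[OF iter]) measurable
  have "zeta_avg k s N \<in> borel_measurable borel"
    unfolding zeta_avg_def by measurable
  then have "zeta_avg k s N \<in> borel_measurable lebesgue"
    by (simp add: measurable_completion)
  then show ?thesis
    by (simp add: cauchy_measure_def)
qed

end

theory Submission
  imports Defs
begin

text \<open>
  The constants may depend on everything but \<open>\<lambda>\<close>, and the right-hand sides do not vanish, because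
  \<open>\<zeta>(2\<sigma>)/2 + \<zeta>(2\<sigma> - 1)/(2\<sigma> - 1) < 0\<close>.  Since \<open>(N + 1) (R\<^bsub>N+1\<^esub> - R\<^sub>N)\<close> is the difference of
  \<open>\<zeta>(s + i T\<^bsup>k(N+1)\<^esup> x)\<close> and \<open>R\<^sub>N\<close>, its \<open>L\<^sup>4\<close> norm is bounded uniformly in \<open>N\<close> once \<open>T\<close> is known to
  preserve the Cauchy measure and \<open>\<zeta>\<close> to have a finite fourth moment with respect to it; both estimates
  then follow from \<open>\<Sum> 1/(N + 1)\<^sup>2 < \<infinity>\<close>, the second one by Markov's inequality for the second
  moment of the square function.

  For the fourth moment, write \<open>\<zeta>(s)/s\<close> as minus the Fourier transform of \<open>u \<mapsto> frac(e\<^sup>u) e\<^bsup>-\<sigma>u\<^esup>\<close>.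
  Differencing with step \<open>1/K\<close> in \<open>u\<close> multiplies this by \<open>1 - e\<^bsup>-s/K\<^esup>\<close>, which is of size
  \<open>|s|/K\<close> for \<open>|t| \<le> K/4\<close>, and the differenced function is small in \<open>L\<^sup>1\<close> and \<open>L\<^sup>2\<close>.  A Bessel
  inequality gives \<open>|\<zeta>| = O(K\<^bsup>1-\<sigma>\<^esup>)\<close> and a square mean \<open>O(K)\<close> on \<open>|t| \<le> K/4\<close>, which suffice for
  \<open>\<sigma> > 1/2\<close>.
\<close>

section \<open>The zeta function in the half plane of positive real part\<close>

text \<open>The power \<open>l\<^sup>2\<close> in (ii) forces fourth moments: Markov's inequality
  for the square function itself gives only 1/l, so its square has to be integrated, and that
  involves |\<zeta>|^4. Plancherel for \<zeta>(s)/s would control just the second moment of \<zeta>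
  against the Cauchy weight, which is of size 1/(1 + y^2). Differencing gives more, because the same
  differenced function yields a pointwise bound through its L^1 norm and a localised mean square
  through its L^2 norm. On |y| of size K the exponents are 2(1 - \<sigma>) from one pointwise
  |\<zeta>|^2, 1 from the mean square of the other and -2 from the weight; the total 1 - 2\<sigma>
  is negative exactly for \<sigma> > 1/2. The step 1/K fits the jumps of frac(e^u) at u = ln n: up
  to u = ln K a step crosses at most one jump, and beyond ln K the trivial bound is good
  enough.\<close>

definition frac_piece :: "nat \<Rightarrow> complex \<Rightarrow> complex" where
  "frac_piece n s = (LINT u:{ln (real n + 1)..ln (real n + 2)}|lborel.
     of_real (exp u - (real n + 1)) * exp (- s * of_real u))"

text \<open>Writing exp u - (n + 1) instead of frac (exp u) keeps the integrand continuous up to the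
  right endpoint, so that the fundamental theorem of calculus applies on the closed
  interval.\<close>

lemma frac_piece_integrable:
  fixes s :: complex
  shows "set_integrable lborel {ln (real n + 1)..ln (real n + 2)}
     (\<lambda>u. of_real (exp u - (real n + 1)) * exp (- s * of_real u))"
  by (intro borel_integrable_atLeastAtMost' continuous_intros)

lemma has_vector_derivative_exp_of_real:
  fixes c :: complex
  shows "((\<lambda>u. exp (c * of_real u)) has_vector_derivative c * exp (c * of_real x)) (at x within A)"
  by (rule has_vector_derivative_real_field) (auto intro!: derivative_eq_intros)

lemma exp_mult_ln_of_nat:
  "m > 0 \<Longrightarrow> exp (w * complex_of_real (ln (real m))) = of_nat m powr w"
  using Ln_of_real[of "real m"] by (simp add: powr_def)

lemma frac_piece_eq:
  assumes "s \<noteq> 0" "s \<noteq> 1"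
  shows "frac_piece n s = (of_nat (Suc (Suc n)) powr (1 - s) - of_nat (Suc n) powr (1 - s)) / (1 - s)
    + of_nat (Suc n) * (of_nat (Suc (Suc n)) powr (- s) - of_nat (Suc n) powr (- s)) / s"
proof -
  define F where "F = (\<lambda>u::real. exp ((1 - s) * of_real u) / (1 - s)
      + of_nat (Suc n) * exp (- s * of_real u) / s)"
  have "frac_piece n s = F (ln (real n + 2)) - F (ln (real n + 1))"
    unfolding frac_piece_def set_lebesgue_integral_def
  proof (rule integral_FTC_Icc)
    show "ln (real n + 1) \<le> ln (real n + 2)" by simp
    fix x :: real
    have "exp ((1 - s) * complex_of_real x) = exp (of_real x) * exp (- s * of_real x)"
      by (simp add: algebra_simps flip: exp_add)
    then have eq: "of_real (exp x - (real n + 1)) * exp (- s * of_real x)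
      = exp ((1 - s) * complex_of_real x) - of_nat (Suc n) * exp (- s * of_real x)"
      by (simp add: algebra_simps exp_of_real)
    show "(F has_vector_derivative of_real (exp x - (real n + 1)) * exp (- s * of_real x))
      (at x within {ln (real n + 1)..ln (real n + 2)})"
    proof -
      have "(F has_vector_derivative (1 - s) * exp ((1 - s) * of_real x) / (1 - s)
          + of_nat (Suc n) * (- s * exp (- s * of_real x)) / s) (at x within {ln (real n + 1)..ln (real n + 2)})"
        unfolding F_def
        by (intro has_vector_derivative_add has_vector_derivative_divide has_vector_derivative_mult_right
            has_vector_derivative_exp_of_real)
      also have "(1 - s) * exp ((1 - s) * of_real x) / (1 - s) + of_nat (Suc n) * (- s * exp (- s * of_real x)) / s
          = exp ((1 - s) * complex_of_real x) - of_nat (Suc n) * exp (- s * of_real x)"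
        using assms by simp
      finally show ?thesis unfolding eq .
    qed
  qed (intro continuous_intros)
  moreover have "exp (w * complex_of_real (ln (real n + 1))) = of_nat (Suc n) powr w"
    "exp (w * complex_of_real (ln (real n + 2))) = of_nat (Suc (Suc n)) powr w" for w
    using exp_mult_ln_of_nat[of "Suc n" w] exp_mult_ln_of_nat[of "Suc (Suc n)" w] by (simp_all add: add_ac)
  ultimately show ?thesis
    unfolding F_def by (simp only:) (simp add: diff_divide_distrib algebra_simps)
qed

lemma norm_exp_mult_of_real: "norm (exp (- s * complex_of_real u)) = exp (- Re s * u)"
  by simp

text \<open>The first factor is at most 1, the exponential at most (n + 1) powr (- Re s), and the
  interval has length ln (1 + 1 / (n + 1)) \<le> 1 / (n + 1). This is the decay that
  \<open>half_plane_series\<close> asks for with c = 0.\<close>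

lemma norm_frac_piece_le:
  assumes "Re s > 0"
  shows "norm (frac_piece n s) \<le> real (Suc n) powr (- Re s - 1)"
proof -
  let ?I = "{ln (real n + 1)..ln (real n + 2)}"
  have "norm (frac_piece n s) \<le> (LINT u:?I|lborel. norm (of_real (exp u - (real n + 1)) * exp (- s * of_real u)))"
    unfolding frac_piece_def by (rule set_integral_norm_bound[OF frac_piece_integrable])
  also have "\<dots> \<le> (LINT u:?I|lborel. real (Suc n) powr (- Re s))"
  proof (rule set_integral_mono)
    show "set_integrable lborel ?I (\<lambda>u. norm (of_real (exp u - (real n + 1)) * exp (- s * of_real u)))"
      by (rule set_integrable_norm[OF frac_piece_integrable])
    show "set_integrable lborel ?I (\<lambda>u. real (Suc n) powr (- Re s))"
      by (intro borel_integrable_atLeastAtMost' continuous_intros)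
    fix u assume u: "u \<in> ?I"
    then have "exp u \<le> exp (ln (real n + 2))" "exp (ln (real n + 1)) \<le> exp u"
      by (simp_all only: exp_le_cancel_iff atLeastAtMost_iff)
    moreover have "exp (ln (real n + 2)) = real n + 2" "exp (ln (real n + 1)) = real n + 1" by simp_all
    ultimately have "exp u \<le> real n + 2" "real n + 1 \<le> exp u" by (simp_all only:)
    moreover have "exp (- Re s * u) \<le> exp (- Re s * ln (real n + 1))"
      using u assms by simp
    then have "exp (- Re s * u) \<le> real (Suc n) powr (- Re s)"
      by (simp add: powr_def add_ac)
    ultimately have "\<bar>exp u - (real n + 1)\<bar> * exp (- Re s * u) \<le> 1 * real (Suc n) powr (- Re s)"
      by (intro mult_mono) auto
    then show "norm (of_real (exp u - (real n + 1)) * exp (- s * of_real u)) \<le> real (Suc n) powr (- Re s)"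
      unfolding norm_mult norm_exp_mult_of_real norm_of_real by simp
  qed
  also have "\<dots> = (ln (real n + 2) - ln (real n + 1)) * real (Suc n) powr (- Re s)"
    by (simp add: set_lebesgue_integral_def)
  also have "\<dots> \<le> (1 / real (Suc n)) * real (Suc n) powr (- Re s)"
  proof (intro mult_right_mono)
    have "ln (1 + 1 / (real n + 1)) \<le> 1 / (real n + 1)" by (rule ln_add_one_self_le_self) simp
    also have "1 + 1 / (real n + 1) = (real n + 2) / (real n + 1)" by (simp add: field_simps)
    finally show "ln (real n + 2) - ln (real n + 1) \<le> 1 / real (Suc n)"
      by (simp add: ln_div add_ac)
  qed simp
  also have "\<dots> = real (Suc n) powr (- Re s - 1)"
    by (simp add: powr_diff)
  finally show ?thesis .
qed

text \<open>With x = exp u the pieces add up to the integral of frac x * x powr (- s - 1) over [1,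
  infinity). This is the classical formula \<zeta>(s) = s / (s - 1) - s * integral, where the
  Dirichlet series is available.\<close>

lemma zeta_sums_frac_piece_gt_1:
  assumes "Re s > 1"
  shows "(\<lambda>n. frac_piece n s) sums (1 / (s - 1) - riemann_zeta s / s)"
proof -
  have s: "s \<noteq> 0" "s \<noteq> 1" using assms by auto
  have Z: "(\<lambda>n. 1 / of_nat (Suc n) powr s) sums riemann_zeta s"
    using is_zeta_riemann_zeta assms by (simp add: is_zeta_def)
  \<comment> \<open>Summation by parts in closed form. The first N pieces reach up to x = N + 1,
    hence the \<open>Suc N\<close> Dirichlet terms.\<close>
  have part: "(\<Sum>n<N. frac_piece n s) = (of_nat (Suc N) powr (1 - s) - 1) / (1 - s)
      + (of_nat (Suc N) powr (1 - s) - (\<Sum>n<Suc N. 1 / of_nat (Suc n) powr s)) / s" for N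
  proof (induction N)
    case (Suc N)
    have p: "of_nat (Suc M) powr (1 - s) = of_nat (Suc M) * of_nat (Suc M) powr (- s)" for M
      by (simp add: powr_diff powr_minus divide_inverse del: of_nat_Suc)
    have q: "1 / of_nat (Suc M) powr s = of_nat (Suc M) powr (- s)" for M
      by (simp add: powr_minus divide_inverse del: of_nat_Suc)
    define S where "S = (\<Sum>n<Suc N. 1 / of_nat (Suc n) powr s)"
    define c where "c = (of_nat (Suc N) :: complex)"
    define d where "d = (of_nat (Suc (Suc N)) :: complex)"
    have dc: "d = c + 1" by (simp add: c_def d_def)
    have "(\<Sum>n<Suc N. frac_piece n s) = (c powr (1 - s) - 1) / (1 - s) + (c powr (1 - s) - S) / s + frac_piece N s"
      by (simp only: sum.lessThan_Suc[of "\<lambda>n. frac_piece n s"] Suc S_def c_def)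
    also have "\<dots> = (d powr (1 - s) - 1) / (1 - s) + (c * d powr (- s) - S) / s"
      unfolding frac_piece_eq[OF s] c_def[symmetric] d_def[symmetric] p[of N, folded c_def]
      by (simp add: diff_divide_distrib algebra_simps)
    also have "c * d powr (- s) - S = d powr (1 - s) - (S + d powr (- s))"
      unfolding p[of "Suc N", folded d_def] by (simp add: dc algebra_simps)
    also have "S + d powr (- s) = (\<Sum>n<Suc (Suc N). 1 / of_nat (Suc n) powr s)"
      unfolding S_def sum.lessThan_Suc[of _ "Suc N"] q d_def ..
    finally show ?case unfolding d_def .
  qed (use s in simp)
  have "(\<lambda>N. (of_nat (Suc N) powr (1 - s) - 1) / (1 - s)
      + (of_nat (Suc N) powr (1 - s) - (\<Sum>n<Suc N. 1 / of_nat (Suc n) powr s)) / s)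
      \<longlonglongrightarrow> (0 - 1) / (1 - s) + (0 - riemann_zeta s) / s"
    using Z unfolding sums_def
    by (intro tendsto_intros tendsto_powr_neg[OF assms] LIMSEQ_Suc) (use s in auto)
  also have "(0 - 1) / (1 - s) + (0 - riemann_zeta s) / s = 1 / (s - 1) - riemann_zeta s / s"
    using s by (simp add: field_simps)
  finally show ?thesis unfolding sums_def part .
qed

lemma zeta_sums_frac_piece:
  assumes "Re s > 0" "s \<noteq> 1"
  shows "(\<lambda>n. frac_piece n s) sums (1 / (s - 1) - riemann_zeta s / s)"
proof -
  \<comment> \<open>The factor (s - 1) * s clears the denominators of \<open>frac_piece_eq\<close>;
    at s = 1 both sides of \<open>a_eq\<close> vanish. So every term is visibly holomorphic on the
    whole half plane, and the identity theorem carries the formula over from Re s > 1.\<close>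
  define a where "a = (\<lambda>n s. (s - 1) * s * frac_piece n s)"
  have nz: "(of_nat (Suc n) :: complex) \<noteq> 0" for n by (simp del: of_nat_Suc)
  have a_eq: "a n s = - s * (of_nat (Suc (Suc n)) powr (1 - s) - of_nat (Suc n) powr (1 - s))
    + (s - 1) * of_nat (Suc n) * (of_nat (Suc (Suc n)) powr (- s) - of_nat (Suc n) powr (- s))"
    if "s \<noteq> 0" for n s
  proof (cases "s = 1")
    case True
    then show ?thesis by (simp add: a_def powr_0 nz del: of_nat_Suc)
  next
    case False
    have "(s - 1) * s * (A / (1 - s) + B / s) = - s * A + (s - 1) * B" for A B
      using that False by (simp add: field_simps)
    then show ?thesis unfolding a_def frac_piece_eq[OF that False] by (simp only: mult.assoc times_divide_eq_right[symmetric]) simp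
  qed
  have "\<exists>g. g holomorphic_on {s. Re s > 0} \<and> (\<forall>s. Re s > 0 \<longrightarrow> (\<lambda>n. a n s) sums g s)"
  proof (rule half_plane_series[where B = "\<lambda>s. norm ((s - 1) * s)"])
    fix n
    show "a n holomorphic_on {s. Re s > 0}"
    proof (rule holomorphic_transform)
      show "(\<lambda>s. - s * (of_nat (Suc (Suc n)) powr (1 - s) - of_nat (Suc n) powr (1 - s))
        + (s - 1) * of_nat (Suc n) * (of_nat (Suc (Suc n)) powr (- s) - of_nat (Suc n) powr (- s)))
        holomorphic_on {s. Re s > 0}"
        by (intro holomorphic_intros) (use nz in \<open>auto simp del: of_nat_Suc\<close>)
    qed (rule a_eq[symmetric], auto)
  next
    fix n and s :: complex assume "Re s > 0"
    then show "norm (a n s) \<le> norm ((s - 1) * s) * real (Suc n) powr (0 - Re s - 1)"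
      unfolding a_def norm_mult[of "(s - 1) * s"] using norm_frac_piece_le[of s n] by (intro mult_left_mono) auto
  qed (intro continuous_intros)
  then obtain g where g: "g holomorphic_on {s. Re s > 0}" "\<And>s. Re s > 0 \<Longrightarrow> (\<lambda>n. a n s) sums g s" by blast
  have "g s = s - (s - 1) * riemann_zeta s"
  proof (rule analytic_continuation_open[where f = g and g = "\<lambda>s. s - (s - 1) * riemann_zeta s"
        and s = "{s. Re s > 1}" and s' = "{s. Re s > 0} - {1}" and z = s])
    show "connected ({s. Re s > 0} - {1 :: complex})"
      by (rule connected_open_delete) (auto intro: convex_connected convex_halfspace_Re_gt open_halfspace_Re_gt)
    have "(2::complex) \<in> {s. Re s > 1}" by simp
    then show "{s. Re s > 1} \<noteq> {}" by blast
    show "(\<lambda>s. s - (s - 1) * riemann_zeta s) holomorphic_on {s. Re s > 0} - {1}"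
      using is_zeta_riemann_zeta unfolding is_zeta_def
      by (auto intro!: holomorphic_intros intro: holomorphic_on_subset)
    fix z assume "z \<in> {s. Re s > 1}"
    then have z: "Re z > 1" "z \<noteq> 0" "z \<noteq> 1" by auto
    have "(\<lambda>n. a n z) sums ((z - 1) * z * (1 / (z - 1) - riemann_zeta z / z))"
      unfolding a_def by (intro sums_mult zeta_sums_frac_piece_gt_1 z)
    moreover have "(z - 1) * z * (1 / (z - 1) - riemann_zeta z / z) = z - (z - 1) * riemann_zeta z"
      using z by (simp add: field_simps)
    ultimately show "g z = z - (z - 1) * riemann_zeta z"
      using g(2)[of z] z sums_unique2 by force
  qed (use assms g in \<open>auto simp: open_halfspace_Re_gt intro: holomorphic_on_subset\<close>)
  moreover have "s \<noteq> 0" using assms by auto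
  moreover have "(\<lambda>n. a n s / ((s - 1) * s)) sums (g s / ((s - 1) * s))"
    using g(2)[OF assms(1)] by (rule sums_divide)
  moreover have "(s - (s - 1) * riemann_zeta s) / ((s - 1) * s) = 1 / (s - 1) - riemann_zeta s / s"
    using \<open>s \<noteq> 0\<close> assms by (simp add: field_simps)
  ultimately show ?thesis using assms by (simp add: a_def)
qed

section \<open>Zeta as a Mellin transform\<close>

lemma nn_integral_exp_atLeast:
  fixes a L :: real
  assumes "a > 0"
  shows "(\<integral>\<^sup>+u. ennreal (exp (- a * u)) * indicator {L..} u \<partial>lborel) = ennreal (exp (- a * L) / a)"
proof -
  have "((\<lambda>u. - exp (- a * u) / a) \<longlongrightarrow> 0) at_top" using assms by real_asymp
  then have "(\<integral>\<^sup>+u. ennreal (exp (- a * u)) * indicator {L..} u \<partial>lborel) = ennreal (0 - (- exp (- a * L) / a))"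
    using assms by (intro nn_integral_FTC_atLeast) (auto intro!: derivative_eq_intros)
  then show ?thesis by simp
qed

lemma nn_integral_exp_atMost:
  fixes a L :: real
  assumes "a > 0"
  shows "(\<integral>\<^sup>+u. ennreal (exp (a * u)) * indicator {..L} u \<partial>lborel) = ennreal (exp (a * L) / a)"
proof -
  have "(\<integral>\<^sup>+u. ennreal (exp (a * u)) * indicator {..L} u \<partial>lborel)
      = (\<integral>\<^sup>+u. ennreal (exp (- a * u)) * indicator {- L..} u \<partial>lborel)"
    by (subst nn_integral_real_affine[where t = 0 and c = "-1"])
       (auto intro!: nn_integral_cong simp: indicator_def)
  then show ?thesis using nn_integral_exp_atLeast[OF assms, of "- L"] by simp
qed

definition mellin_frac :: "complex \<Rightarrow> real \<Rightarrow> complex" where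
  "mellin_frac s u = of_real (frac (exp u)) * exp (- s * of_real u)"

lemma mellin_frac_measurable[measurable]: "mellin_frac s \<in> borel_measurable borel"
  unfolding mellin_frac_def frac_def by measurable

lemma norm_mellin_frac: "norm (mellin_frac s u) = frac (exp u) * exp (- Re s * u)"
  by (simp add: mellin_frac_def norm_mult)

lemma frac_of_less_1: "0 \<le> x \<Longrightarrow> x < 1 \<Longrightarrow> frac (x::real) = x"
  by (simp add: frac_eq)

text \<open>frac (exp u) equals exp u for u < 0 and is below 1 otherwise, so the decay rate is 1 -
  Re s on the left and Re s on the right. Both are positive exactly in the critical strip.\<close>

lemma integrable_mellin_frac:
  assumes "0 < Re s" "Re s < 1"
  shows "integrable lborel (mellin_frac s)"
proof (rule integrableI_bounded)
  have "norm (mellin_frac s u) \<le> exp ((1 - Re s) * u) * indicator {..0} u + exp (- Re s * u) * indicator {0..} u" for u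
  proof (cases "u < 0")
    case True
    then have "frac (exp u) = exp u" by (intro frac_of_less_1) auto
    then show ?thesis using True by (simp add: norm_mellin_frac algebra_simps flip: exp_add)
  next
    case False
    have "frac (exp u) * exp (- Re s * u) \<le> 1 * exp (- Re s * u)"
      by (intro mult_right_mono) (auto intro: less_imp_le frac_lt_1)
    then show ?thesis using False by (auto simp: norm_mellin_frac indicator_def)
  qed
  then have "ennreal (norm (mellin_frac s u)) \<le>
      ennreal (exp ((1 - Re s) * u) * indicator {..0} u + exp (- Re s * u) * indicator {0..} u)" for u
    by (rule ennreal_leI)
  also have "ennreal (exp ((1 - Re s) * u) * indicator {..0} u + exp (- Re s * u) * indicator {0..} u)
      = ennreal (exp ((1 - Re s) * u)) * indicator {..0} u + ennreal (exp (- Re s * u)) * indicator {0..} u" for u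
    by (subst ennreal_plus) (auto simp: ennreal_mult' ennreal_indicator)
  finally have "(\<integral>\<^sup>+u. norm (mellin_frac s u) \<partial>lborel) \<le>
      (\<integral>\<^sup>+u. ennreal (exp ((1 - Re s) * u)) * indicator {..0} u + ennreal (exp (- Re s * u)) * indicator {0..} u \<partial>lborel)"
    by (intro nn_integral_mono) simp
  also have "\<dots> = ennreal (1 / (1 - Re s)) + ennreal (1 / Re s)"
    by (subst nn_integral_add) (use assms nn_integral_exp_atLeast[of "Re s" 0] nn_integral_exp_atMost[of "1 - Re s" 0] in auto)
  also have "\<dots> < \<infinity>" by simp
  finally show "(\<integral>\<^sup>+u. norm (mellin_frac s u) \<partial>lborel) < \<infinity>" .
qed simp

lemma integral_mellin_frac_neg:
  assumes "0 < Re s" "Re s < 1"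
  shows "(LINT u:{..<0}|lborel. mellin_frac s u) = 1 / (1 - s)"
proof -
  define F where "F = (\<lambda>u::real. exp ((1 - s) * of_real u) / (1 - s))"
  have s: "s \<noteq> 1" using assms by auto
  have eq: "mellin_frac s u = exp ((1 - s) * of_real u)" if "u < 0" for u
  proof -
    have "frac (exp u) = exp u" using that by (intro frac_of_less_1) auto
    then show ?thesis by (simp add: mellin_frac_def algebra_simps flip: exp_add exp_of_real)
  qed
  have int: "set_integrable lborel {..<0} (mellin_frac s)"
    using integrable_mellin_frac[OF assms] unfolding set_integrable_def
    by (intro integrable_mult_indicator) auto
  have "(LINT u:{..<0}|lborel. mellin_frac s u) = (LINT u:{..<0}|lborel. exp ((1 - s) * of_real u))"
    by (rule set_lebesgue_integral_cong) (auto simp: eq)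
  also have "\<dots> = (LBINT u=-\<infinity>..ereal 0. exp ((1 - s) * of_real u))"
    by (simp add: interval_lebesgue_integral_def)
  also have "\<dots> = F 0 - 0"
  proof (rule interval_integral_FTC_integrable)
    show "(F has_vector_derivative exp ((1 - s) * of_real x)) (at x)" for x
    proof -
      have "(F has_vector_derivative (1 - s) * exp ((1 - s) * of_real x) / (1 - s)) (at x)"
        unfolding F_def by (intro has_vector_derivative_divide has_vector_derivative_exp_of_real)
      then show ?thesis using s by simp
    qed
    show "isCont (\<lambda>u. exp ((1 - s) * complex_of_real u)) x" for x
      by (intro continuous_intros)
    have "set_integrable lborel {..<0} (\<lambda>u. exp ((1 - s) * complex_of_real u))"
      using int by (rule set_integrable_cong[THEN iffD1, rotated 3]) (auto simp: eq)
    then show "set_integrable lborel (einterval (- \<infinity>) (ereal 0)) (\<lambda>u. exp ((1 - s) * complex_of_real u))"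
      by simp
    have "(F \<longlongrightarrow> 0) at_bot"
    proof (rule tendsto_norm_zero_cancel)
      have "((\<lambda>u. exp ((1 - Re s) * u) / norm (1 - s)) \<longlongrightarrow> 0) at_bot"
        using assms s by real_asymp
      then show "((\<lambda>u. norm (F u)) \<longlongrightarrow> 0) at_bot" by (simp add: F_def norm_divide)
    qed
    then show "((F \<circ> real_of_ereal) \<longlongrightarrow> 0) (at_right (- \<infinity>))"
      by (simp add: ereal_tendsto_simps)
    have "(F \<longlongrightarrow> F 0) (at_left 0)"
      unfolding F_def using s by (intro tendsto_intros) auto
    then show "((F \<circ> real_of_ereal) \<longlongrightarrow> F 0) (at_left (ereal 0))"
      by (simp add: ereal_tendsto_simps del: zero_ereal_def)
  qed simp
  finally show ?thesis by (simp add: F_def)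
qed

text \<open>The half-open intervals tile [0, infinity) disjointly and omit the point where frac
  jumps back to 0; that endpoint is a null set.\<close>

lemma integral_mellin_frac_piece:
  "(LINT u:{ln (real n + 1)..<ln (real n + 2)}|lborel. mellin_frac s u) = frac_piece n s"
  unfolding frac_piece_def set_lebesgue_integral_def
proof (rule integral_cong_AE)
  have "AE u in lborel. u \<noteq> ln (real n + 2)" by (rule AE_lborel_singleton)
  then show "AE u in lborel. indicat_real {ln (real n + 1)..<ln (real n + 2)} u *\<^sub>R mellin_frac s u =
         indicat_real {ln (real n + 1)..ln (real n + 2)} u *\<^sub>R
         (complex_of_real (exp u - (real n + 1)) * exp (- s * complex_of_real u))"
  proof eventually_elim
    case (elim u)
    show ?case
    proof (cases "u \<in> {ln (real n + 1)..<ln (real n + 2)}")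
      case True
      then have "exp (ln (real n + 1)) \<le> exp u" "exp u < exp (ln (real n + 2))"
        by (simp_all only: exp_le_cancel_iff exp_less_cancel_iff atLeastLessThan_iff)
      moreover have "exp (ln (real n + 2)) = real n + 2" "exp (ln (real n + 1)) = real n + 1" by simp_all
      ultimately have "real n + 1 \<le> exp u" "exp u < real n + 2" by (simp_all only:)
      then have "\<lfloor>exp u\<rfloor> = int n + 1" by (intro floor_unique) auto
      then have "frac (exp u) = exp u - (real n + 1)" by (simp add: frac_def)
      then show ?thesis using True by (simp add: mellin_frac_def)
    qed (use elim in auto)
  qed
qed measurable

lemma ln_intervals_cover: "(\<Union>n. {ln (real n + 1)..<ln (real n + 2)}) = {0..}"
proof (intro equalityI subsetI)
  fix u :: real assume u: "u \<in> {0..}"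
  define n where "n = nat \<lfloor>exp u\<rfloor> - 1"
  have "exp u \<ge> 1" using u by simp
  then have "\<lfloor>exp u\<rfloor> \<ge> 1" by linarith
  then have "int n + 1 = \<lfloor>exp u\<rfloor>" unfolding n_def by linarith
  then have "real n + 1 = of_int \<lfloor>exp u\<rfloor>" by (metis of_int_of_nat_eq of_int_add of_int_1)
  then have "real n + 1 \<le> exp u" "exp u < real n + 2" by linarith+
  then have "ln (real n + 1) \<le> ln (exp u)" "ln (exp u) < ln (real n + 2)"
    by (subst ln_le_cancel_iff ln_less_cancel_iff; simp)+
  then show "u \<in> (\<Union>n. {ln (real n + 1)..<ln (real n + 2)})" by auto
next
  fix u assume "u \<in> (\<Union>n. {ln (real n + 1)..<ln (real n + 2)})"
  then obtain n where "ln (real n + 1) \<le> u" by auto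
  moreover have "0 \<le> ln (real n + 1)" by simp
  ultimately show "u \<in> {0..}" unfolding atLeast_iff by (rule order_trans[rotated])
qed

text \<open>The half line u < 0 contributes 1 / (1 - s), which cancels the pole term 1 / (s - 1) of
  the series over u \<ge> 0.\<close>

lemma zeta_mellin:
  assumes "0 < Re s" "Re s < 1"
  shows "(LINT u|lborel. mellin_frac s u) = - riemann_zeta s / s"
proof -
  have int: "set_integrable lborel A (mellin_frac s)" if "A \<in> sets lborel" for A
    using integrable_mellin_frac[OF assms] that unfolding set_integrable_def
    by (intro integrable_mult_indicator) auto
  have disj: "{ln (real m + 1)..<ln (real m + 2)} \<inter> {ln (real n + 1)..<ln (real n + 2)} = {}" if "m < n" for m n
  proof -
    have "ln (real m + 2) \<le> ln (real n + 1)" using that by simp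
    then show ?thesis by auto
  qed
  have "(LINT u|lborel. mellin_frac s u) = (LINT u:{..<0} \<union> {0..}|lborel. mellin_frac s u)"
  proof -
    have "{..<0} \<union> {0..} = (UNIV :: real set)" by auto
    then show ?thesis by (simp add: set_lebesgue_integral_def)
  qed
  also have "\<dots> = (LINT u:{..<0}|lborel. mellin_frac s u) + (LINT u:{0..}|lborel. mellin_frac s u)"
    by (intro set_integral_Un int) auto
  also have "(LINT u:{0..}|lborel. mellin_frac s u) = (\<Sum>n. frac_piece n s)"
    unfolding integral_mellin_frac_piece[symmetric] ln_intervals_cover[symmetric]
    by (rule lebesgue_integral_countable_add) (use disj in \<open>auto intro: int simp: nat_neq_iff Int_commute\<close>)
  also have "\<dots> = 1 / (s - 1) - riemann_zeta s / s"
    by (intro sums_unique[symmetric] zeta_sums_frac_piece) (use assms in auto)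
  also have "(LINT u:{..<0}|lborel. mellin_frac s u) = 1 / (1 - s)"
    by (rule integral_mellin_frac_neg[OF assms])
  finally show ?thesis using assms by (simp add: divide_simps) (auto simp: algebra_simps)
qed

section \<open>The sign of \<zeta>(2\<sigma>)/2 + \<zeta>(2\<sigma> - 1)/(2\<sigma> - 1)\<close>

lemma Re_frac_piece_ge:
  assumes "v > 0"
  shows "Re (frac_piece n (of_real v)) \<ge> real (n + 2) powr (- v - 1) / 2"
proof -
  let ?I = "{ln (real n + 1)..ln (real n + 2)}"
  have le: "ln (real n + 1) \<le> ln (real n + 2)" by simp
  define c where "c = real (n + 2) powr (- v - 1)"
  have c: "c \<ge> 0" by (simp add: c_def)
  \<comment> \<open>exp (- v * u) is split as exp (- (v + 1) * u) * exp u. The first factor is at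
    least its value \<open>c\<close> at the right end; the second is the Jacobian of x = exp u, so
    the minorant is c * (x - (n + 1)) integrated over a unit interval, giving c / 2.\<close>
  have "(LINT u:?I|lborel. c * (exp (2 * u) - (real n + 1) * exp u))
      = c * (exp (2 * ln (real n + 2)) / 2 - (real n + 1) * exp (ln (real n + 2)))
        - c * (exp (2 * ln (real n + 1)) / 2 - (real n + 1) * exp (ln (real n + 1)))"
    unfolding set_lebesgue_integral_def
    by (rule integral_FTC_Icc[OF le, where F = "\<lambda>u. c * (exp (2 * u) / 2 - (real n + 1) * exp u)"])
       (auto intro!: derivative_eq_intros continuous_intros simp flip: has_real_derivative_iff_has_vector_derivative)
  also have "\<dots> = c / 2"
  proof -
    have "exp (2 * ln (real n + 2)) = (real n + 2)\<^sup>2" "exp (2 * ln (real n + 1)) = (real n + 1)\<^sup>2"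
      by (simp_all add: exp_double)
    then show ?thesis by (simp add: power2_eq_square field_simps)
  qed
  finally have 1: "(LINT u:?I|lborel. c * (exp (2 * u) - (real n + 1) * exp u)) = c / 2" .
  have "(LINT u:?I|lborel. c * (exp (2 * u) - (real n + 1) * exp u))
      \<le> (LINT u:?I|lborel. (exp u - (real n + 1)) * exp (- v * u))"
  proof (rule set_integral_mono)
    fix u assume "u \<in> ?I"
    then have u: "exp (ln (real n + 1)) \<le> exp u" "u \<le> ln (real n + 2)"
      by (simp_all only: exp_le_cancel_iff atLeastAtMost_iff)
    then have ge: "real n + 1 \<le> exp u" by simp
    have "c = exp (- (v + 1) * ln (real n + 2))" by (simp add: c_def powr_def algebra_simps)
    also have "\<dots> \<le> exp (- (v + 1) * u)" using u assms by simp
    finally have *: "c * (exp u * (exp u - (real n + 1))) \<le> exp (- (v + 1) * u) * (exp u * (exp u - (real n + 1)))"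
      using ge by (intro mult_right_mono) auto
    also have "\<dots> = (exp (- (v + 1) * u) * exp u) * (exp u - (real n + 1))" by simp
    also have "exp (- (v + 1) * u) * exp u = exp (- v * u)" by (simp add: algebra_simps flip: exp_add)
    finally have *: "c * (exp u * (exp u - (real n + 1))) \<le> (exp u - (real n + 1)) * exp (- v * u)"
      by (simp only: mult.commute)
    show "c * (exp (2 * u) - (real n + 1) * exp u) \<le> (exp u - (real n + 1)) * exp (- v * u)"
    proof -
      have "exp (2 * u) = exp u * exp u" by (simp flip: exp_add)
      then have "exp (2 * u) - (real n + 1) * exp u = exp u * (exp u - (real n + 1))"
        by (simp only: right_diff_distrib mult.commute)
      then show ?thesis using * by (simp only:)
    qed
  qed (intro borel_integrable_atLeastAtMost' continuous_intros)+
  also have "\<dots> = (LINT u:?I|lborel. Re (of_real (exp u - (real n + 1)) * exp (- of_real v * of_real u)))"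
    by (intro set_lebesgue_integral_cong) (auto simp: Re_exp)
  also have "\<dots> = Re (frac_piece n (of_real v))"
    unfolding frac_piece_def set_lebesgue_integral_def
    using integral_Re[OF frac_piece_integrable[of n "of_real v", unfolded set_integrable_def]] by simp
  finally show ?thesis unfolding 1 by (simp only: c_def)
qed

text \<open>With v = 2\<sigma> - 1 the pieces sum to 1 / (v - 1) - \<zeta>(v) / v, and their lower
  bounds sum to (\<zeta>(v + 1) - 1) / 2. Hence the combination is at most 1/2 - 1 / (1 - v), which
  is below -1/2.\<close>

lemma zeta_combination_neg:
  assumes "1 / 2 < \<sigma>" "\<sigma> < 1"
  shows "Re (riemann_zeta (of_real (2 * \<sigma>)) / 2
           + riemann_zeta (of_real (2 * \<sigma> - 1)) / of_real (2 * \<sigma> - 1)) < 0"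
proof -
  define w v where "w = 2 * \<sigma>" and "v = 2 * \<sigma> - 1"
  have wv: "1 < w" "w < 2" "0 < v" "v < 1" "w = v + 1" using assms by (auto simp: w_def v_def)
  have "(\<lambda>n. 1 / of_nat (Suc n) powr complex_of_real w) sums riemann_zeta (of_real w)"
    using is_zeta_riemann_zeta wv unfolding is_zeta_def by simp
  then have "(\<lambda>n. Re (1 / of_nat (Suc n) powr complex_of_real w)) sums Re (riemann_zeta (of_real w))"
    by (rule sums_Re)
  also have "(\<lambda>n. Re (1 / of_nat (Suc n) powr complex_of_real w)) = (\<lambda>n. real (Suc n) powr (- w))"
  proof
    fix n
    have "(1 / of_nat (Suc n) powr complex_of_real w) = complex_of_real (real (Suc n) powr (- w))"
      by (simp add: powr_minus powr_of_real[symmetric] divide_inverse del: of_nat_Suc)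
    then show "Re (1 / of_nat (Suc n) powr complex_of_real w) = real (Suc n) powr (- w)"
      by (simp del: of_nat_Suc)
  qed
  finally have "(\<lambda>n. real (Suc n) powr (- w)) sums Re (riemann_zeta (of_real w))" .
  \<comment> \<open>The first Dirichlet term 1 is dropped, since the lower bounds start at n +
    2.\<close>
  then have "(\<lambda>n. real (Suc (Suc n)) powr (- w)) sums (Re (riemann_zeta (of_real w)) - 1)"
    by (subst sums_Suc_iff) simp
  then have 1: "(\<lambda>n. real (n + 2) powr (- v - 1) / 2) sums ((Re (riemann_zeta (of_real w)) - 1) / 2)"
  proof (intro sums_divide)
    have "- v - 1 = - w" using wv by simp
    then show "(\<lambda>n. real (Suc (Suc n)) powr (- w)) sums (Re (riemann_zeta (of_real w)) - 1) \<Longrightarrow>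
      (\<lambda>n. real (n + 2) powr (- v - 1)) sums (Re (riemann_zeta (of_real w)) - 1)"
      by (simp only:) simp
  qed
  have "(\<lambda>n. frac_piece n (of_real v)) sums (1 / (of_real v - 1) - riemann_zeta (of_real v) / of_real v)"
    using wv by (intro zeta_sums_frac_piece) auto
  then have 2: "(\<lambda>n. Re (frac_piece n (of_real v))) sums Re (1 / (of_real v - 1) - riemann_zeta (of_real v) / of_real v)"
    by (rule sums_Re)
  have "(Re (riemann_zeta (of_real w)) - 1) / 2 \<le> Re (1 / (of_real v - 1) - riemann_zeta (of_real v) / of_real v)"
    using wv by (intro sums_le[OF Re_frac_piece_ge 1 2]) auto
  also have "\<dots> = - 1 / (1 - v) - Re (riemann_zeta (of_real v) / of_real v)"
  proof -
    have "1 / (complex_of_real v - 1) = of_real (- 1 / (1 - v))" using wv by (simp add: field_simps)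
    then show ?thesis by (simp del: of_real_minus of_real_divide)
  qed
  finally have "Re (riemann_zeta (of_real w)) / 2 + Re (riemann_zeta (of_real v) / of_real v) \<le> 1 / 2 - 1 / (1 - v)"
    by (simp add: diff_divide_distrib)
  moreover have "1 / (1 - v) > 1" using wv by simp
  moreover have "Re (riemann_zeta (of_real w) / 2) = Re (riemann_zeta (of_real w)) / 2" by simp
  ultimately show ?thesis unfolding plus_complex.sel w_def v_def by linarith
qed

section \<open>A Bessel inequality for the Fourier transform\<close>

lemma nn_integral_gaussian:
  fixes K c :: real
  assumes "K > 0"
  shows "(\<integral>\<^sup>+w. ennreal (exp (- ((K * (w - c))\<^sup>2 / 2))) \<partial>lborel) = ennreal (sqrt (2 * pi) / K)"
proof -
  interpret prob_space "density lborel (normal_density c (1 / K))"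
    using assms by (intro prob_space_normal_density) simp
  have "exp (- ((K * (w - c))\<^sup>2 / 2)) = sqrt (2 * pi) / K * normal_density c (1 / K) w" for w
  proof -
    have "- (w - c)\<^sup>2 / (2 * (1 / K)\<^sup>2) = - ((K * (w - c))\<^sup>2 / 2)"
      using assms by (simp add: power_mult_distrib power_one_over)
    moreover have "sqrt (2 * pi * (1 / K)\<^sup>2) = sqrt (2 * pi) / K"
      using assms by (simp add: real_sqrt_mult power_one_over real_sqrt_divide)
    ultimately show ?thesis using assms unfolding normal_density_def by simp
  qed
  then have "(\<integral>\<^sup>+w. ennreal (exp (- ((K * (w - c))\<^sup>2 / 2))) \<partial>lborel)
      = (\<integral>\<^sup>+w. ennreal (sqrt (2 * pi) / K) * ennreal (normal_density c (1 / K) w) \<partial>lborel)"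
    using assms by (intro nn_integral_cong) (simp only: ennreal_mult'[symmetric] divide_nonneg_pos real_sqrt_ge_zero pi_ge_zero mult_nonneg_nonneg zero_le_numeral)
  also have "\<dots> = ennreal (sqrt (2 * pi) / K) * (\<integral>\<^sup>+w. ennreal (normal_density c (1 / K) w) \<partial>lborel)"
    by (rule nn_integral_cmult) simp
  also have "(\<integral>\<^sup>+w. ennreal (normal_density c (1 / K) w) \<partial>lborel) = 1"
    using emeasure_space_1 by (simp add: emeasure_density)
  finally show ?thesis by simp
qed

text \<open>In the non-integrable case the left side is 0, the default value of the Bochner
  integral.\<close>

lemma integral_norm_bound_ennreal':
  fixes f :: "'a \<Rightarrow> 'b :: {banach, second_countable_topology}"
  shows "ennreal (norm (integral\<^sup>L M f)) \<le> (\<integral>\<^sup>+x. norm (f x) \<partial>M)"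
  by (cases "integrable M f") (simp_all add: integral_norm_bound_ennreal not_integrable_integral_eq)

text \<open>Schur's test: |\<phi> u| |\<phi> v| is at most the mean of the two squares, and in each
  half the other variable is free and integrates the Gaussian to sqrt (2 * pi) / K.\<close>

lemma nn_integral_gaussian_form_le:
  fixes \<phi> :: "real \<Rightarrow> real" and K :: real
  assumes [measurable]: "\<phi> \<in> borel_measurable borel" and K: "K > 0"
  shows "(\<integral>\<^sup>+u. \<integral>\<^sup>+v. ennreal (\<bar>\<phi> u\<bar> * \<bar>\<phi> v\<bar> * exp (- ((K * (u - v))\<^sup>2 / 2))) \<partial>lborel \<partial>lborel)
      \<le> ennreal (sqrt (2 * pi) / K) * (\<integral>\<^sup>+u. ennreal ((\<phi> u)\<^sup>2) \<partial>lborel)"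
proof -
  let ?g = "\<lambda>u v. ennreal (exp (- ((K * (u - v))\<^sup>2 / 2)))"
  let ?c = "ennreal (sqrt (2 * pi) / K)"
  have sym: "?g u v = ?g v u" for u v by (simp add: power2_eq_square algebra_simps)
  have 1: "(\<integral>\<^sup>+v. ennreal ((\<phi> u)\<^sup>2 / 2) * ?g u v \<partial>lborel) = ennreal ((\<phi> u)\<^sup>2 / 2) * ?c" for u
    by (subst sym, subst nn_integral_cmult) (auto simp: nn_integral_gaussian[OF K])
  have 2: "(\<integral>\<^sup>+u. ennreal ((\<phi> v)\<^sup>2 / 2) * ?g u v \<partial>lborel) = ennreal ((\<phi> v)\<^sup>2 / 2) * ?c" for v
    by (subst nn_integral_cmult) (auto simp: nn_integral_gaussian[OF K])
  have "ennreal (\<bar>\<phi> u\<bar> * \<bar>\<phi> v\<bar> * exp (- ((K * (u - v))\<^sup>2 / 2)))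
      \<le> ennreal ((\<phi> u)\<^sup>2 / 2) * ?g u v + ennreal ((\<phi> v)\<^sup>2 / 2) * ?g u v" for u v
  proof -
    have "0 \<le> (\<bar>\<phi> u\<bar> - \<bar>\<phi> v\<bar>)\<^sup>2" by simp
    then have "\<bar>\<phi> u\<bar> * \<bar>\<phi> v\<bar> \<le> (\<phi> u)\<^sup>2 / 2 + (\<phi> v)\<^sup>2 / 2" by (simp add: power2_diff)
    then have "\<bar>\<phi> u\<bar> * \<bar>\<phi> v\<bar> * exp (- ((K * (u - v))\<^sup>2 / 2))
        \<le> ((\<phi> u)\<^sup>2 / 2 + (\<phi> v)\<^sup>2 / 2) * exp (- ((K * (u - v))\<^sup>2 / 2))"
      by (rule mult_right_mono) simp
    from ennreal_leI[OF this] show ?thesis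
      by (simp only: distrib_right ennreal_plus ennreal_mult' zero_le_power2 zero_le_divide_iff zero_le_numeral exp_ge_zero
          mult_nonneg_nonneg add_nonneg_nonneg divide_nonneg_pos simp_thms zero_less_numeral)
  qed
  then have "(\<integral>\<^sup>+u. \<integral>\<^sup>+v. ennreal (\<bar>\<phi> u\<bar> * \<bar>\<phi> v\<bar> * exp (- ((K * (u - v))\<^sup>2 / 2))) \<partial>lborel \<partial>lborel)
      \<le> (\<integral>\<^sup>+u. \<integral>\<^sup>+v. ennreal ((\<phi> u)\<^sup>2 / 2) * ?g u v + ennreal ((\<phi> v)\<^sup>2 / 2) * ?g u v \<partial>lborel \<partial>lborel)"
    by (intro nn_integral_mono) simp
  also have "\<dots> = (\<integral>\<^sup>+u. \<integral>\<^sup>+v. ennreal ((\<phi> u)\<^sup>2 / 2) * ?g u v \<partial>lborel \<partial>lborel)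
      + (\<integral>\<^sup>+u. \<integral>\<^sup>+v. ennreal ((\<phi> v)\<^sup>2 / 2) * ?g u v \<partial>lborel \<partial>lborel)"
    by (simp add: nn_integral_add)
  also have "(\<integral>\<^sup>+u. \<integral>\<^sup>+v. ennreal ((\<phi> v)\<^sup>2 / 2) * ?g u v \<partial>lborel \<partial>lborel)
      = (\<integral>\<^sup>+v. \<integral>\<^sup>+u. ennreal ((\<phi> v)\<^sup>2 / 2) * ?g u v \<partial>lborel \<partial>lborel)"
    by (rule lborel_pair.Fubini') measurable
  also have "(\<integral>\<^sup>+u. \<integral>\<^sup>+v. ennreal ((\<phi> u)\<^sup>2 / 2) * ?g u v \<partial>lborel \<partial>lborel)
      + (\<integral>\<^sup>+v. \<integral>\<^sup>+u. ennreal ((\<phi> v)\<^sup>2 / 2) * ?g u v \<partial>lborel \<partial>lborel)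
      = (\<integral>\<^sup>+u. ennreal ((\<phi> u)\<^sup>2 / 2) * ?c + ennreal ((\<phi> u)\<^sup>2 / 2) * ?c \<partial>lborel)"
    unfolding 1 2 by (rule nn_integral_add[symmetric]) measurable
  also have "\<dots> = (\<integral>\<^sup>+u. ?c * ennreal ((\<phi> u)\<^sup>2) \<partial>lborel)"
    by (intro nn_integral_cong) (simp add: mult.commute flip: distrib_left ennreal_plus)
  also have "\<dots> = ?c * (\<integral>\<^sup>+u. ennreal ((\<phi> u)\<^sup>2) \<partial>lborel)"
    by (rule nn_integral_cmult) measurable
  finally show ?thesis .
qed

definition fourier :: "(real \<Rightarrow> real) \<Rightarrow> real \<Rightarrow> complex" where
  "fourier \<phi> t = (LINT u|lborel. of_real (\<phi> u) * iexp (- (t * u)))"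

lemma fourier_measurable[measurable]:
  assumes [measurable]: "\<phi> \<in> borel_measurable borel"
  shows "fourier \<phi> \<in> borel_measurable borel"
  unfolding fourier_def by measurable

lemma fourier_integrand_integrable:
  "integrable lborel \<phi> \<Longrightarrow> integrable lborel (\<lambda>u. complex_of_real (\<phi> u) * iexp (- (t * u)))"
  by (rule Bochner_Integration.integrable_bound[of _ \<phi>]) (auto simp: norm_mult)

lemma norm_fourier_le:
  assumes "integrable lborel \<phi>"
  shows "norm (fourier \<phi> t) \<le> (LINT u|lborel. \<bar>\<phi> u\<bar>)"
proof -
  have "norm (fourier \<phi> t) \<le> (LINT u|lborel. norm (complex_of_real (\<phi> u) * iexp (- (t * u))))"
    unfolding fourier_def by (rule integral_norm_bound)
  then show ?thesis by (simp add: norm_mult)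
qed

text \<open>Integrating \<open>|fourier \<phi>|\<^sup>2\<close> against a Gaussian turns it into a quadratic form with the
  Gaussian kernel, which Schur's test bounds.\<close>
lemma fourier_gaussian_le:
  fixes \<phi> :: "real \<Rightarrow> real" and K :: real
  assumes int: "integrable lborel \<phi>" and K: "K > 0"
  shows "(\<integral>\<^sup>+z. ennreal ((norm (fourier \<phi> (K * z)))\<^sup>2) \<partial>std_normal_distribution)
      \<le> ennreal (sqrt (2 * pi) / K) * (\<integral>\<^sup>+u. ennreal ((\<phi> u)\<^sup>2) \<partial>lborel)"
proof -
  let ?N = std_normal_distribution
  let ?F = "\<lambda>z. fourier \<phi> (K * z)"
  let ?e = "\<lambda>z u. iexp (- (K * z * u))"
  let ?G = "\<lambda>u v. exp (- ((K * (u - v))\<^sup>2 / 2))"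
  define B where "B = (LINT u|lborel. \<bar>\<phi> u\<bar>)"
  have B: "norm (?F z) \<le> B" for z unfolding B_def by (rule norm_fourier_le[OF int])
  have \<phi>[measurable]: "\<phi> \<in> borel_measurable borel" using int by auto
  interpret N: prob_space ?N by (rule prob_space_normal_density) simp
  interpret pair_sigma_finite ?N "lborel :: real measure" ..
  have intF: "integrable ?N (\<lambda>z. f z)" if "\<And>z. norm (f z) \<le> C" and "f \<in> borel_measurable ?N"
    for f :: "real \<Rightarrow> 'b :: {banach, second_countable_topology}" and C
    using that by (intro N.integrable_const_bound[of _ C]) auto
  \<comment> \<open>Kept general in the bounded factor \<open>h\<close> because Fubini is used
    twice: with \<open>h\<close> an exponential for the inner transform, and with \<open>h\<close>
    the conjugate of the transform itself.\<close>
  have pair_int: "integrable (?N \<Otimes>\<^sub>M lborel) (\<lambda>(z, u). complex_of_real (\<phi> u) * ?e z u * h z)"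
    if h: "\<And>z. norm (h z) \<le> C" and [measurable]: "h \<in> borel_measurable borel" for h C
  proof (rule Fubini_integrable)
    show "AE z in ?N. integrable lborel (\<lambda>u. case (z, u) of (z, u) \<Rightarrow> complex_of_real (\<phi> u) * ?e z u * h z)"
    proof (rule AE_I2, unfold prod.case)
      fix z
      show "integrable lborel (\<lambda>u. complex_of_real (\<phi> u) * ?e z u * h z)"
        by (intro integrable_mult_left fourier_integrand_integrable int)
    qed
    have nm: "(LINT u|lborel. norm (complex_of_real (\<phi> u) * ?e z u * h z)) = B * norm (h z)" for z
      by (simp add: norm_mult B_def)
    have "integrable ?N (\<lambda>z. B * norm (h z))"
      by (rule integrable_mult_right, rule intF[of _ C]) (simp_all add: h)
    then show "integrable ?N (\<lambda>z. LINT u|lborel. norm (case (z, u) of (z, u) \<Rightarrow> complex_of_real (\<phi> u) * ?e z u * h z))"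
      by (simp only: prod.case nm)
    show "(\<lambda>(z, u). complex_of_real (\<phi> u) * ?e z u * h z) \<in> borel_measurable (?N \<Otimes>\<^sub>M lborel)"
      by simp
  qed
  have F: "?F z = (LINT u|lborel. complex_of_real (\<phi> u) * ?e z u)" for z
    by (simp add: fourier_def)
  \<comment> \<open>Expanding the conjugate transform and integrating over z first leaves the
    characteristic function of the standard normal law at K * (v - u), which is the Gaussian
    kernel.\<close>
  have inner: "(LINT z|?N. ?e z u * cnj (?F z)) = of_real (LINT v|lborel. \<phi> v * ?G u v)" for u
  proof -
    have "?e z u * cnj (?F z) = (LINT v|lborel. complex_of_real (\<phi> v) * ?e z (- v) * ?e z u)" for z
    proof -
      have "cnj (complex_of_real (\<phi> v) * ?e z v) = complex_of_real (\<phi> v) * ?e z (- v)" for v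
        by (simp add: exp_cnj)
      then have "cnj (?F z) = (LINT v|lborel. complex_of_real (\<phi> v) * ?e z (- v))"
        unfolding F Bochner_Integration.integral_cnj[symmetric] by (simp only:)
      then have "?e z u * cnj (?F z) = (LINT v|lborel. complex_of_real (\<phi> v) * ?e z (- v)) * ?e z u"
        by (simp only: mult.commute)
      also have "\<dots> = (LINT v|lborel. complex_of_real (\<phi> v) * ?e z (- v) * ?e z u)"
        by (rule integral_mult_left_zero[symmetric])
      finally show ?thesis .
    qed
    then have "(LINT z|?N. ?e z u * cnj (?F z)) = (LINT z|?N. LINT v|lborel. complex_of_real (\<phi> v) * ?e z (- v) * ?e z u)"
      by (simp only:)
    also have "\<dots> = (LINT v|lborel. LINT z|?N. complex_of_real (\<phi> v) * ?e z (- v) * ?e z u)"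
    proof (rule Fubini_integral[symmetric])
      have "integrable (?N \<Otimes>\<^sub>M lborel) (\<lambda>(z, v). complex_of_real (\<phi> v) * ?e z v * (?e z (- u)))"
        by (rule pair_int[of _ 1]) auto
      then have "integrable (?N \<Otimes>\<^sub>M lborel) (\<lambda>x. cnj (case x of (z, v) \<Rightarrow> complex_of_real (\<phi> v) * ?e z v * (?e z (- u))))"
        by (rule integrable_cnj)
      also have "(\<lambda>x. cnj (case x of (z, v) \<Rightarrow> complex_of_real (\<phi> v) * ?e z v * (?e z (- u))))
          = (\<lambda>(z, v). complex_of_real (\<phi> v) * ?e z (- v) * ?e z u)"
        by (auto simp: exp_cnj)
      finally show "integrable (?N \<Otimes>\<^sub>M lborel) (\<lambda>(z, v). complex_of_real (\<phi> v) * ?e z (- v) * ?e z u)" .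
    qed
    also have "\<dots> = (LINT v|lborel. complex_of_real (\<phi> v * ?G u v))"
    proof (intro Bochner_Integration.integral_cong refl)
      fix v
      have "complex_of_real (\<phi> v) * ?e z (- v) * ?e z u = complex_of_real (\<phi> v) * iexp ((K * (v - u)) * z)" for z
        by (simp add: algebra_simps flip: exp_add)
      then have "(LINT z|?N. complex_of_real (\<phi> v) * ?e z (- v) * ?e z u)
          = (LINT z|?N. complex_of_real (\<phi> v) * iexp ((K * (v - u)) * z))"
        by (simp only:)
      also have "\<dots> = complex_of_real (\<phi> v) * (LINT z|?N. iexp ((K * (v - u)) * z))"
        by (rule integral_mult_right_zero)
      also have "(LINT z|?N. iexp ((K * (v - u)) * z)) = char ?N (K * (v - u))"
        by (simp add: char_def)
      also have "\<dots> = ?G u v"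
        by (simp add: char_std_normal_distribution power_mult_distrib power2_commute)
      finally show "(LINT z|?N. complex_of_real (\<phi> v) * ?e z (- v) * ?e z u) = complex_of_real (\<phi> v * ?G u v)"
        by simp
    qed
    finally show ?thesis by (simp only: integral_complex_of_real)
  qed
  have [measurable]: "(\<lambda>z. cnj (?F z)) \<in> borel_measurable borel"
    by (rule borel_measurable_continuous_on[where f = cnj]) (intro continuous_intros, measurable)
  have "complex_of_real (LINT z|?N. (norm (?F z))\<^sup>2) = (LINT z|?N. ?F z * cnj (?F z))"
    by (simp only: complex_norm_square[symmetric] integral_complex_of_real[symmetric])
  also have "\<dots> = (LINT z|?N. LINT u|lborel. complex_of_real (\<phi> u) * ?e z u * cnj (?F z))"
    by (simp only: F integral_mult_left_zero)
  also have "\<dots> = (LINT u|lborel. LINT z|?N. complex_of_real (\<phi> u) * ?e z u * cnj (?F z))"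
    by (rule Fubini_integral[symmetric], rule pair_int[of _ B]) (auto simp: B)
  also have "\<dots> = (LINT u|lborel. complex_of_real (\<phi> u * (LINT v|lborel. \<phi> v * ?G u v)))"
  proof -
    have "complex_of_real (\<phi> u) * ?e z u * c = complex_of_real (\<phi> u) * (?e z u * c)" for u z c
      by (rule mult.assoc)
    then show ?thesis by (simp only: integral_mult_right_zero inner of_real_mult)
  qed
  finally have eq: "(LINT z|?N. (norm (?F z))\<^sup>2) = (LINT u|lborel. \<phi> u * (LINT v|lborel. \<phi> v * ?G u v))"
    by (simp only: integral_complex_of_real of_real_eq_iff)
  have "(\<integral>\<^sup>+z. ennreal ((norm (?F z))\<^sup>2) \<partial>?N) = ennreal (LINT z|?N. (norm (?F z))\<^sup>2)"
    by (intro nn_integral_eq_integral intF[of _ "B\<^sup>2"]) (auto simp: power_mono B)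
  also have "\<dots> \<le> ennreal (norm (LINT u|lborel. \<phi> u * (LINT v|lborel. \<phi> v * ?G u v)))"
    unfolding eq by (intro ennreal_leI) simp
  also have "\<dots> \<le> (\<integral>\<^sup>+u. norm (\<phi> u * (LINT v|lborel. \<phi> v * ?G u v)) \<partial>lborel)"
    by (rule integral_norm_bound_ennreal')
  also have "\<dots> \<le> (\<integral>\<^sup>+u. \<integral>\<^sup>+v. ennreal (\<bar>\<phi> u\<bar> * \<bar>\<phi> v\<bar> * ?G u v) \<partial>lborel \<partial>lborel)"
  proof (intro nn_integral_mono)
    fix u
    have "ennreal (norm (\<phi> u * (LINT v|lborel. \<phi> v * ?G u v)))
      \<le> ennreal \<bar>\<phi> u\<bar> * (\<integral>\<^sup>+v. norm (\<phi> v * ?G u v) \<partial>lborel)"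
    proof -
      have "ennreal (norm (\<phi> u * (LINT v|lborel. \<phi> v * ?G u v)))
          = ennreal \<bar>\<phi> u\<bar> * ennreal (norm (LINT v|lborel. \<phi> v * ?G u v))"
        by (simp only: abs_mult real_norm_def ennreal_mult[OF abs_ge_zero abs_ge_zero])
      then show ?thesis by (simp only: mult_left_mono[OF integral_norm_bound_ennreal'] zero_le)
    qed
    also have "\<dots> = (\<integral>\<^sup>+v. ennreal \<bar>\<phi> u\<bar> * ennreal (norm (\<phi> v * ?G u v)) \<partial>lborel)"
      by (rule nn_integral_cmult[symmetric]) measurable
    also have "\<dots> = (\<integral>\<^sup>+v. ennreal (\<bar>\<phi> u\<bar> * \<bar>\<phi> v\<bar> * ?G u v) \<partial>lborel)"
      by (intro nn_integral_cong) (simp add: abs_mult mult.assoc flip: ennreal_mult')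
    finally show "ennreal (norm (\<phi> u * (LINT v|lborel. \<phi> v * ?G u v)))
      \<le> (\<integral>\<^sup>+v. ennreal (\<bar>\<phi> u\<bar> * \<bar>\<phi> v\<bar> * ?G u v) \<partial>lborel)" .
  qed
  also have "\<dots> \<le> ennreal (sqrt (2 * pi) / K) * (\<integral>\<^sup>+u. ennreal ((\<phi> u)\<^sup>2) \<partial>lborel)"
    by (rule nn_integral_gaussian_form_le[OF \<phi> K])
  finally show ?thesis .
qed

text \<open>For t = K * z in the window, 1 \<le> exp (1 / 2 - z^2 / 2), a multiple of the normal
  density. The Jacobian K cancels the 1 / K of the Gaussian form, so the constant does not depend on
  the window.\<close>

lemma fourier_window_le:
  fixes \<phi> :: "real \<Rightarrow> real" and K :: real
  assumes int: "integrable lborel \<phi>" and K: "K > 0"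
  shows "(\<integral>\<^sup>+t. ennreal ((norm (fourier \<phi> t))\<^sup>2) * indicator {- K..K} t \<partial>lborel)
      \<le> ennreal (2 * pi * exp (1 / 2)) * (\<integral>\<^sup>+u. ennreal ((\<phi> u)\<^sup>2) \<partial>lborel)"
proof -
  let ?f = "\<lambda>t. ennreal ((norm (fourier \<phi> t))\<^sup>2)"
  define c where "c = sqrt (2 * pi) * exp (1 / 2)"
  have c0: "c \<ge> 0" by (simp add: c_def)
  have \<phi>[measurable]: "\<phi> \<in> borel_measurable borel" using int by auto
  have "(\<integral>\<^sup>+t. ?f t * indicator {- K..K} t \<partial>lborel)
      = ennreal K * (\<integral>\<^sup>+z. ?f (K * z) * indicator {- K..K} (K * z) \<partial>lborel)"
    using K by (subst nn_integral_real_affine[where t = 0 and c = K]) auto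
  also have "\<dots> \<le> ennreal K * (\<integral>\<^sup>+z. ennreal c * (ennreal (std_normal_density z) * ?f (K * z)) \<partial>lborel)"
  proof (intro mult_left_mono nn_integral_mono)
    fix z
    show "?f (K * z) * indicator {- K..K} (K * z) \<le> ennreal c * (ennreal (std_normal_density z) * ?f (K * z))"
    proof (cases "\<bar>z\<bar> \<le> 1")
      case True
      then have "z\<^sup>2 \<le> 1" by (simp add: abs_square_le_1)
      then have "1 \<le> exp (1 / 2 - z\<^sup>2 / 2)" by simp
      also have "\<dots> = c * std_normal_density z"
        by (simp add: c_def std_normal_density_def flip: exp_add)
      finally have "ennreal 1 \<le> ennreal c * ennreal (std_normal_density z)"
        using c0 by (subst ennreal_mult[symmetric]) (auto intro: ennreal_leI)
      then have "1 * ?f (K * z) \<le> ennreal c * ennreal (std_normal_density z) * ?f (K * z)"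
        by (intro mult_right_mono) auto
      then show ?thesis by (auto simp: mult.assoc indicator_def)
    next
      case False
      then have "K * 1 < K * \<bar>z\<bar>" using K by (intro mult_strict_left_mono) auto
      also have "\<dots> = \<bar>K * z\<bar>" using K by (simp add: abs_mult)
      finally have "K * z \<notin> {- K..K}" by auto
      then show ?thesis by simp
    qed
  qed simp
  also have "\<dots> = ennreal K * (ennreal c * (\<integral>\<^sup>+z. ?f (K * z) \<partial>std_normal_distribution))"
    by (subst nn_integral_cmult) (auto simp: nn_integral_density)
  also have "\<dots> \<le> ennreal K * (ennreal c * (ennreal (sqrt (2 * pi) / K) * (\<integral>\<^sup>+u. ennreal ((\<phi> u)\<^sup>2) \<partial>lborel)))"
    by (intro mult_left_mono fourier_gaussian_le[OF int K]) auto
  also have "\<dots> = ennreal (K * (c * (sqrt (2 * pi) / K))) * (\<integral>\<^sup>+u. ennreal ((\<phi> u)\<^sup>2) \<partial>lborel)"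
  proof -
    have d: "sqrt (2 * pi) / K \<ge> 0" using K by simp
    then have "c * (sqrt (2 * pi) / K) \<ge> 0" using c0 by (rule mult_nonneg_nonneg[rotated])
    then show ?thesis using K c0 d by (simp only: ennreal_mult less_imp_le mult.assoc)
  qed
  also have "K * (c * (sqrt (2 * pi) / K)) = 2 * pi * exp (1 / 2)"
    using K by (simp add: c_def)
  finally show ?thesis .
qed

section \<open>Bounds for zeta on vertical segments\<close>

definition frac_diff :: "nat \<Rightarrow> real \<Rightarrow> real" where
  "frac_diff K u = frac (exp u) - frac (exp (u - 1 / real K))"

lemma frac_diff_measurable[measurable]: "frac_diff K \<in> borel_measurable borel"
  unfolding frac_diff_def frac_def by measurable

lemma abs_frac_diff_le_1: "\<bar>frac_diff K u\<bar> \<le> 1"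
  unfolding frac_diff_def
  using frac_ge_0[of "exp u"] frac_lt_1[of "exp u"]
    frac_ge_0[of "exp (u - 1 / real K)"] frac_lt_1[of "exp (u - 1 / real K)"]
  by linarith

text \<open>While exp u < K, the increment of exp over the step is at most exp u / K < 1, so at most
  one integer is crossed. If none is, \<open>frac_diff\<close> is that increment; if n is, then u
  lies within 1 / K to the right of ln n.\<close>

lemma frac_diff_cases:
  assumes K: "K > 0" and u: "exp u < real K"
  shows "\<bar>frac_diff K u\<bar> \<le> exp u / real K
    \<or> (\<exists>n\<in>{1..K}. u \<in> {ln (real n)..ln (real n) + 1 / real K})"
proof -
  define h where "h = 1 / real K"
  define m where "m = \<lfloor>exp u\<rfloor> - \<lfloor>exp (u - h)\<rfloor>"
  define d where "d = exp u - exp (u - h)"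
  have h: "h > 0" using K by (simp add: h_def)
  have d0: "d \<ge> 0" using h by (simp add: d_def)
  have "d = exp u * (1 - exp (- h))" by (simp add: d_def algebra_simps flip: exp_add)
  also have "\<dots> \<le> exp u * h" using exp_ge_add_one_self[of "- h"] by (intro mult_left_mono) auto
  finally have dh: "d \<le> exp u / real K" by (simp add: h_def)
  also have "\<dots> < 1" using u K by simp
  finally have d1: "d < 1" .
  have G: "frac_diff K u = d - of_int m" by (simp add: frac_diff_def frac_def d_def m_def h_def)
  have "m \<ge> 0" using h by (simp add: m_def floor_mono)
  moreover have "m \<le> 1" using d1 unfolding m_def d_def by linarith
  ultimately consider "m = 0" | "m = 1" by linarith
  then show ?thesis
  proof cases
    case 1
    then show ?thesis using G d0 dh by simp
  next
    case 2
    define n where "n = nat \<lfloor>exp u\<rfloor>"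
    have "\<lfloor>exp (u - h)\<rfloor> \<ge> 0" by simp
    then have "\<lfloor>exp u\<rfloor> \<ge> 1" using 2 unfolding m_def by linarith
    then have n: "int n = \<lfloor>exp u\<rfloor>" "n \<ge> 1" unfolding n_def by linarith+
    have n': "real n = of_int \<lfloor>exp u\<rfloor>" using n by (metis of_int_of_nat_eq)
    have "real n \<le> exp u" "exp (u - h) < real n" using 2 unfolding n' m_def by linarith+
    moreover from this have "n \<le> K" using u by simp
    ultimately have "ln (real n) \<le> ln (exp u)" "ln (exp (u - h)) < ln (real n)"
      using n by (subst ln_le_cancel_iff ln_less_cancel_iff; simp)+
    then have "u \<in> {ln (real n)..ln (real n) + 1 / real K}" by (simp add: h_def)
    then show ?thesis using n \<open>n \<le> K\<close> by auto
  qed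
qed

text \<open>Three regions: the smooth increments up to ln K give K powr (- a) / (p - a), the K jump
  windows of length 1 / K give the sum, and beyond ln K the trivial bound 1 gives K powr (- a) / a.
  Convergence of the two tails is what 0 < a < p expresses.\<close>

lemma nn_integral_frac_diff_power_le:
  fixes p K :: nat and a :: real
  assumes a: "0 < a" "a < real p" and K: "K > 0"
  shows "(\<integral>\<^sup>+u. ennreal (\<bar>frac_diff K u\<bar> ^ p * exp (- a * u)) \<partial>lborel)
    \<le> ennreal (real K powr (- a) * (1 / (real p - a) + 1 / a)
        + (\<Sum>n=1..K. real n powr (- a)) / real K)"
proof -
  have p: "p > 0" using a by (cases p) auto
  let ?I = "\<lambda>n. {ln (real n)..ln (real n) + 1 / real K}"
  let ?A = "\<lambda>u. ennreal (real K powr (- real p)) * (ennreal (exp ((real p - a) * u)) * indicator {..ln (real K)} u)"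
  let ?B = "\<lambda>u. (\<Sum>n=1..K. ennreal (real n powr (- a)) * indicator (?I n) u)"
  let ?D = "\<lambda>u. ennreal (exp (- a * u)) * indicator {ln (real K)..} u"
  have "ennreal (\<bar>frac_diff K u\<bar> ^ p * exp (- a * u)) \<le> ?A u + ?B u + ?D u" for u
  proof (cases "exp u < real K")
    case False
    then have "ln (real K) \<le> ln (exp u)" using K by (subst ln_le_cancel_iff) auto
    then have "ln (real K) \<le> u" by simp
    moreover have "\<bar>frac_diff K u\<bar> ^ p * exp (- a * u) \<le> 1 * exp (- a * u)"
      by (intro mult_right_mono power_le_one abs_frac_diff_le_1) auto
    ultimately have "ennreal (\<bar>frac_diff K u\<bar> ^ p * exp (- a * u)) \<le> ?D u"
      by (auto intro: ennreal_leI)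
    then show ?thesis by (rule order_trans) simp
  next
    case True
    then have uK: "u \<le> ln (real K)" using K by (simp add: ln_ge_iff)
    from frac_diff_cases[OF K True] show ?thesis
    proof
      assume "\<bar>frac_diff K u\<bar> \<le> exp u / real K"
      then have "\<bar>frac_diff K u\<bar> ^ p \<le> (exp u / real K) ^ p" by (rule power_mono) simp
      also have "\<dots> = real K powr (- real p) * exp (real p * u)"
        using K by (simp add: power_divide powr_minus powr_realpow exp_of_nat_mult) (simp add: field_simps)
      finally have "\<bar>frac_diff K u\<bar> ^ p * exp (- a * u) \<le> (real K powr (- real p) * exp (real p * u)) * exp (- a * u)"
        by (rule mult_right_mono) simp
      also have "\<dots> = real K powr (- real p) * exp ((real p - a) * u)"
        by (simp add: algebra_simps flip: exp_add)
      finally have "ennreal (\<bar>frac_diff K u\<bar> ^ p * exp (- a * u)) \<le> ?A u"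
        using uK by (simp add: ennreal_leI flip: ennreal_mult')
      then show ?thesis by (rule order_trans) (simp add: add.assoc)
    next
      assume "\<exists>n\<in>{1..K}. u \<in> ?I n"
      then obtain n where n: "n \<in> {1..K}" "u \<in> ?I n" by blast
      have "\<bar>frac_diff K u\<bar> ^ p * exp (- a * u) \<le> 1 * exp (- a * ln (real n))"
        using n a by (intro mult_mono power_le_one abs_frac_diff_le_1) auto
      also have "\<dots> = real n powr (- a)" using n by (simp add: powr_def)
      finally have "ennreal (\<bar>frac_diff K u\<bar> ^ p * exp (- a * u)) \<le> ennreal (real n powr (- a)) * indicator (?I n) u"
        using n by (simp add: ennreal_leI)
      also have "\<dots> \<le> ?B u" using n by (intro member_le_sum) auto
      finally show ?thesis
        by (rule order_trans[OF _ add_increasing2[OF zero_le add_increasing[OF zero_le order_refl]]])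
    qed
  qed
  then have "(\<integral>\<^sup>+u. ennreal (\<bar>frac_diff K u\<bar> ^ p * exp (- a * u)) \<partial>lborel)
      \<le> (\<integral>\<^sup>+u. ?A u + ?B u + ?D u \<partial>lborel)"
    by (rule nn_integral_mono)
  also have "\<dots> = (\<integral>\<^sup>+u. ?A u \<partial>lborel) + (\<integral>\<^sup>+u. ?B u \<partial>lborel) + (\<integral>\<^sup>+u. ?D u \<partial>lborel)"
  proof -
    have "(\<integral>\<^sup>+u. ?A u + ?B u + ?D u \<partial>lborel) = (\<integral>\<^sup>+u. ?A u + ?B u \<partial>lborel) + (\<integral>\<^sup>+u. ?D u \<partial>lborel)"
      by (rule nn_integral_add) measurable
    also have "(\<integral>\<^sup>+u. ?A u + ?B u \<partial>lborel) = (\<integral>\<^sup>+u. ?A u \<partial>lborel) + (\<integral>\<^sup>+u. ?B u \<partial>lborel)"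
      by (rule nn_integral_add) measurable
    finally show ?thesis .
  qed
  also have "(\<integral>\<^sup>+u. ?A u \<partial>lborel) = ennreal (real K powr (- a) / (real p - a))"
  proof -
    have "(\<integral>\<^sup>+u. ?A u \<partial>lborel) = ennreal (real K powr (- real p)) * ennreal (exp ((real p - a) * ln (real K)) / (real p - a))"
      using a by (subst nn_integral_cmult) (auto simp: nn_integral_exp_atMost)
    also have "exp ((real p - a) * ln (real K)) = real K powr (real p - a)" using K by (simp add: powr_def)
    finally show ?thesis using a by (simp add: powr_add[symmetric] flip: ennreal_mult')
  qed
  also have "(\<integral>\<^sup>+u. ?D u \<partial>lborel) = ennreal (real K powr (- a) / a)"
    using a K nn_integral_exp_atLeast[of a "ln (real K)"] by (simp add: powr_def)
  also have "(\<integral>\<^sup>+u. ?B u \<partial>lborel) = (\<Sum>n=1..K. ennreal (real n powr (- a) / real K))"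
    by (subst nn_integral_sum) (auto simp: nn_integral_cmult simp flip: ennreal_mult')
  also have "\<dots> = ennreal ((\<Sum>n=1..K. real n powr (- a)) / real K)"
    by (simp add: sum_ennreal sum_divide_distrib)
  also have "ennreal (real K powr (- a) / (real p - a)) + ennreal ((\<Sum>n=1..K. real n powr (- a)) / real K)
      + ennreal (real K powr (- a) / a)
      = ennreal (real K powr (- a) * (1 / (real p - a) + 1 / a) + (\<Sum>n=1..K. real n powr (- a)) / real K)"
    using a by (simp add: sum_nonneg distrib_left flip: ennreal_plus)
  finally show ?thesis .
qed

text \<open>By the mean value theorem each new term is at most an increment of x powr (1 - a) / (1 -
  a).\<close>

lemma sum_powr_neg_le:
  fixes a :: real
  assumes "0 < a" "a < 1" "K \<ge> 1"
  shows "(\<Sum>n=1..K. real n powr (- a)) \<le> real K powr (1 - a) / (1 - a)"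
  using \<open>K \<ge> 1\<close>
proof (induction K rule: dec_induct)
  case base
  then show ?case using assms by simp
next
  case (step K)
  have "\<exists>z>real K. z < real (Suc K) \<and> real (Suc K) powr (1 - a) - real K powr (1 - a)
      = (real (Suc K) - real K) * ((1 - a) * z powr (- a))"
  proof (rule MVT2)
    fix x assume "real K \<le> x" "x \<le> real (Suc K)"
    then have "x > 0" using step by simp
    then show "((\<lambda>x. x powr (1 - a)) has_real_derivative (1 - a) * x powr (- a)) (at x)"
      using has_real_derivative_powr[of x "1 - a"] by simp
  qed simp
  then obtain z where z: "real K < z" "z < real (Suc K)"
    "real (Suc K) powr (1 - a) - real K powr (1 - a) = (1 - a) * z powr (- a)" by auto
  have "real (Suc K) powr (- a) \<le> z powr (- a)"
    using z step assms by (intro powr_mono2') auto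
  also have "\<dots> = (real (Suc K) powr (1 - a) - real K powr (1 - a)) / (1 - a)"
    unfolding z(3) using assms by simp
  finally show ?case using step.IH by (simp add: diff_divide_distrib del: of_nat_Suc)
qed

text \<open>\<open>nn_integral_frac_diff_power_le\<close> with (p, a) = (1, \<sigma>) and (2,
  2\<sigma>). The jump sum grows like K powr (1 - \<sigma>) in the first case; in the second it
  stays bounded because 2\<sigma> > 1, which gives the order 1 / K.\<close>

lemma frac_diff_bounds:
  assumes \<sigma>: "1 / 2 < \<sigma>" "\<sigma> < 1"
  shows "\<exists>C>0. \<forall>K\<ge>1.
      (\<integral>\<^sup>+u. ennreal \<bar>frac_diff K u * exp (- \<sigma> * u)\<bar> \<partial>lborel) \<le> ennreal (C * real K powr (- \<sigma>)) \<and>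
      (\<integral>\<^sup>+u. ennreal ((frac_diff K u * exp (- \<sigma> * u))\<^sup>2) \<partial>lborel) \<le> ennreal (C / real K)"
proof -
  define Z where "Z = (\<Sum>n. real n powr (- (2 * \<sigma>)))"
  have sm: "summable (\<lambda>n. real n powr (- (2 * \<sigma>)))" using \<sigma> by (simp add: summable_real_powr_iff)
  have Z0: "Z \<ge> 0" unfolding Z_def by (intro suminf_nonneg sm) simp
  define C where "C = 2 / (1 - \<sigma>) + 1 / \<sigma> + Z"
  have "C > 0" using \<sigma> Z0 by (simp add: C_def add_pos_nonneg add_pos_pos)
  moreover have "(\<integral>\<^sup>+u. ennreal \<bar>frac_diff K u * exp (- \<sigma> * u)\<bar> \<partial>lborel) \<le> ennreal (C * real K powr (- \<sigma>))"
    if K: "K \<ge> 1" for K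
  proof -
    have "(\<integral>\<^sup>+u. ennreal \<bar>frac_diff K u * exp (- \<sigma> * u)\<bar> \<partial>lborel)
        = (\<integral>\<^sup>+u. ennreal (\<bar>frac_diff K u\<bar> ^ 1 * exp (- \<sigma> * u)) \<partial>lborel)"
      by (simp add: abs_mult)
    also have "\<dots> \<le> ennreal (real K powr (- \<sigma>) * (1 / (real 1 - \<sigma>) + 1 / \<sigma>)
        + (\<Sum>n=1..K. real n powr (- \<sigma>)) / real K)"
      by (rule nn_integral_frac_diff_power_le) (use \<sigma> K in auto)
    also have "\<dots> \<le> ennreal (C * real K powr (- \<sigma>))"
    proof (rule ennreal_leI)
      have "(\<Sum>n=1..K. real n powr (- \<sigma>)) / real K \<le> (real K powr (1 - \<sigma>) / (1 - \<sigma>)) / real K"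
        using \<sigma> K by (intro divide_right_mono sum_powr_neg_le) auto
      also have "\<dots> = real K powr (- \<sigma>) * (1 / (1 - \<sigma>))"
        using K by (simp add: powr_diff powr_minus divide_inverse)
      finally have "real K powr (- \<sigma>) * (1 / (real 1 - \<sigma>) + 1 / \<sigma>) + (\<Sum>n=1..K. real n powr (- \<sigma>)) / real K
        \<le> real K powr (- \<sigma>) * (1 / (1 - \<sigma>) + 1 / \<sigma>) + real K powr (- \<sigma>) * (1 / (1 - \<sigma>))" by simp
      also have "\<dots> = (2 / (1 - \<sigma>) + 1 / \<sigma>) * real K powr (- \<sigma>)" by (simp add: algebra_simps)
      also have "\<dots> \<le> C * real K powr (- \<sigma>)" using Z0 by (intro mult_right_mono) (auto simp: C_def)
      finally show "real K powr (- \<sigma>) * (1 / (real 1 - \<sigma>) + 1 / \<sigma>) + (\<Sum>n=1..K. real n powr (- \<sigma>)) / real K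
        \<le> C * real K powr (- \<sigma>)" .
    qed
    finally show ?thesis .
  qed
  moreover have "(\<integral>\<^sup>+u. ennreal ((frac_diff K u * exp (- \<sigma> * u))\<^sup>2) \<partial>lborel) \<le> ennreal (C / real K)"
    if K: "K \<ge> 1" for K
  proof -
    have "(frac_diff K u * exp (- \<sigma> * u))\<^sup>2 = \<bar>frac_diff K u\<bar> ^ 2 * exp (- (2 * \<sigma>) * u)" for u
      by (simp add: power_mult_distrib flip: exp_double)
    then have "(\<integral>\<^sup>+u. ennreal ((frac_diff K u * exp (- \<sigma> * u))\<^sup>2) \<partial>lborel)
        = (\<integral>\<^sup>+u. ennreal (\<bar>frac_diff K u\<bar> ^ 2 * exp (- (2 * \<sigma>) * u)) \<partial>lborel)"
      by (simp only:)
    also have "\<dots> \<le> ennreal (real K powr (- (2 * \<sigma>)) * (1 / (real 2 - 2 * \<sigma>) + 1 / (2 * \<sigma>))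
        + (\<Sum>n=1..K. real n powr (- (2 * \<sigma>))) / real K)"
      by (rule nn_integral_frac_diff_power_le) (use \<sigma> K in auto)
    also have "\<dots> \<le> ennreal (C / real K)"
    proof (rule ennreal_leI)
      have s: "(\<Sum>n=1..K. real n powr (- (2 * \<sigma>))) / real K \<le> Z / real K"
        unfolding Z_def by (intro divide_right_mono sum_le_suminf sm) auto
      have "real K powr (- (2 * \<sigma>)) \<le> real K powr (- 1)" using \<sigma> K by (intro powr_mono) auto
      then have k: "real K powr (- (2 * \<sigma>)) \<le> 1 / real K" using K by (simp add: powr_minus divide_inverse)
      have c: "1 / (real 2 - 2 * \<sigma>) \<le> 2 / (1 - \<sigma>)" "1 / (2 * \<sigma>) \<le> 1 / \<sigma>"
        using \<sigma> by (simp_all add: field_simps)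
      have "real K powr (- (2 * \<sigma>)) * (1 / (real 2 - 2 * \<sigma>) + 1 / (2 * \<sigma>)) \<le> (1 / real K) * (2 / (1 - \<sigma>) + 1 / \<sigma>)"
        using \<sigma> by (intro mult_mono k add_mono c) auto
      then show "real K powr (- (2 * \<sigma>)) * (1 / (real 2 - 2 * \<sigma>) + 1 / (2 * \<sigma>))
        + (\<Sum>n=1..K. real n powr (- (2 * \<sigma>))) / real K \<le> C / real K"
        using s by (simp add: C_def add_divide_distrib)
    qed
    finally show ?thesis .
  qed
  ultimately show ?thesis by blast
qed

text \<open>Translating u by 1 / K leaves the integral unchanged, but the factor exp (- s * u) is
  not translated along with frac, which costs exp (- s / K).\<close>

lemma fourier_frac_diff:
  assumes s: "0 < \<sigma>" "\<sigma> < 1"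
  shows "fourier (\<lambda>u. frac_diff K u * exp (- \<sigma> * u)) t
    = (1 - exp (- Complex \<sigma> t / of_nat K)) * (- riemann_zeta (Complex \<sigma> t) / Complex \<sigma> t)"
proof -
  let ?s = "Complex \<sigma> t"
  define h where "h = 1 / real K"
  have int: "integrable lborel (mellin_frac ?s)" using s by (intro integrable_mellin_frac) auto
  have sh: "(LINT u|lborel. mellin_frac ?s (u - h)) = (LINT u|lborel. mellin_frac ?s u)"
    using lborel_integral_real_affine[of 1 "mellin_frac ?s" "- h"] by simp
  have ints: "integrable lborel (\<lambda>u. mellin_frac ?s (u - h))"
    using lborel_integrable_real_affine[OF int, of 1 "- h"] by simp
  have "complex_of_real (frac_diff K u * exp (- \<sigma> * u)) * iexp (- (t * u))
      = mellin_frac ?s u - exp (- ?s * of_real h) * mellin_frac ?s (u - h)" for u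
  proof -
    have e: "complex_of_real (exp (- \<sigma> * u)) * iexp (- (t * u)) = exp (- ?s * of_real u)"
      by (simp add: exp_of_real[symmetric] Complex_eq algebra_simps flip: exp_add)
    have "exp (- ?s * of_real h) * exp (- ?s * of_real (u - h)) = exp (- ?s * of_real u)"
      by (simp add: algebra_simps flip: exp_add)
    then have m: "exp (- ?s * of_real h) * mellin_frac ?s (u - h) = of_real (frac (exp (u - h))) * exp (- ?s * of_real u)"
      unfolding mellin_frac_def by (metis mult.left_commute)
    have "complex_of_real (frac_diff K u * exp (- \<sigma> * u)) * iexp (- (t * u))
        = of_real (frac_diff K u) * (complex_of_real (exp (- \<sigma> * u)) * iexp (- (t * u)))"
      by (simp only: of_real_mult[of "frac_diff K u" "exp (- \<sigma> * u)"] mult.assoc)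
    also have "\<dots> = mellin_frac ?s u - exp (- ?s * of_real h) * mellin_frac ?s (u - h)"
      unfolding e m unfolding mellin_frac_def frac_diff_def h_def
      by (simp only: of_real_diff left_diff_distrib)
    finally show ?thesis .
  qed
  then have "fourier (\<lambda>u. frac_diff K u * exp (- \<sigma> * u)) t
      = (LINT u|lborel. mellin_frac ?s u - exp (- ?s * of_real h) * mellin_frac ?s (u - h))"
    unfolding fourier_def by (simp only:)
  also have "\<dots> = (1 - exp (- ?s * of_real h)) * (LINT u|lborel. mellin_frac ?s u)"
    by (subst Bochner_Integration.integral_diff[OF int]) (auto simp: ints sh left_diff_distrib)
  also have "(LINT u|lborel. mellin_frac ?s u) = - riemann_zeta ?s / ?s"
    using s by (intro zeta_mellin) auto
  finally show ?thesis by (simp add: h_def)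
qed

text \<open>The second-order Taylor remainder is at most exp (1 / 2) * norm z * (1 / 2) \<le> 7/8 *
  norm z, which leaves 1/8 of the linear term. The bound 7/4 for exp (1 / 2) comes from e \<le> 3
  \<le> 49/16.\<close>

lemma norm_one_minus_exp_ge:
  fixes z :: complex
  assumes "norm z \<le> 1 / 2"
  shows "norm z / 8 \<le> norm (1 - exp (- z))"
proof -
  have "exp (1 / 2) ^ 2 \<le> (7 / 4 :: real) ^ 2"
    using exp_le by (simp add: power2_eq_square flip: exp_add)
  then have e: "exp (1 / 2) \<le> (7 / 4 :: real)" by (rule power2_le_imp_le) simp
  have "norm (exp (- z) - (1 - z)) \<le> exp \<bar>Re z\<bar> * (norm z)\<^sup>2"
    using Taylor_exp[of "- z" 1] by (simp add: numeral_2_eq_2)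
  also have "\<dots> \<le> 7 / 4 * (norm z * (1 / 2))"
    unfolding power2_eq_square
  proof (intro mult_mono)
    have "exp \<bar>Re z\<bar> \<le> exp (1 / 2)" using abs_Re_le_cmod[of z] assms by simp
    then show "exp \<bar>Re z\<bar> \<le> 7 / 4" using e by (rule order_trans)
  qed (use assms in auto)
  finally have "norm (exp (- z) - (1 - z)) \<le> 7 / 8 * norm z" by simp
  moreover have "norm z \<le> norm (1 - exp (- z)) + norm (exp (- z) - (1 - z))"
    using norm_triangle_ineq[of "1 - exp (- z)" "exp (- z) - (1 - z)"] by simp
  ultimately show ?thesis by linarith
qed

lemma zeta_bounds:
  assumes \<sigma>: "1 / 2 < \<sigma>" "\<sigma> < 1"
  shows "\<exists>C>0. \<forall>K\<ge>4.
      (\<forall>t. \<bar>t\<bar> \<le> real K / 4 \<longrightarrow> norm (riemann_zeta (Complex \<sigma> t)) \<le> C * real K powr (1 - \<sigma>)) \<and>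
      (\<integral>\<^sup>+t. ennreal ((norm (riemann_zeta (Complex \<sigma> t)))\<^sup>2)
            * indicator {- (real K / 4)..real K / 4} t \<partial>lborel) \<le> ennreal (C * real K)"
proof -
  obtain C where C: "C > 0" and C12: "\<forall>K\<ge>1.
      (\<integral>\<^sup>+u. ennreal \<bar>frac_diff K u * exp (- \<sigma> * u)\<bar> \<partial>lborel) \<le> ennreal (C * real K powr (- \<sigma>)) \<and>
      (\<integral>\<^sup>+u. ennreal ((frac_diff K u * exp (- \<sigma> * u))\<^sup>2) \<partial>lborel) \<le> ennreal (C / real K)"
    using frac_diff_bounds[OF \<sigma>] by blast
  note C1 = C12[rule_format, THEN conjunct1] and C2 = C12[rule_format, THEN conjunct2]
  define \<phi> where "\<phi> = (\<lambda>K u. frac_diff K u * exp (- \<sigma> * u))"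
  have [measurable]: "\<phi> K \<in> borel_measurable borel" for K unfolding \<phi>_def by measurable
  have int: "integrable lborel (\<phi> K)" if "K \<ge> 1" for K
  proof (rule integrableI_bounded)
    show "(\<integral>\<^sup>+u. norm (\<phi> K u) \<partial>lborel) < \<infinity>"
      using C1[OF that] unfolding \<phi>_def real_norm_def by (rule le_less_trans) simp
  qed measurable
  \<comment> \<open>K \<ge> 4 gives \<sigma> \<le> K / 4, so |s / K| \<le> 1/2 and the factor 1 -
    exp (- s / K) can be divided out at the cost of 8 * K / |s|. This |s| cancels against the one in
    \<zeta>(s) / s.\<close>
  have zeta_le: "norm (riemann_zeta (Complex \<sigma> t)) \<le> 8 * real K * norm (fourier (\<phi> K) t)"
    if K: "K \<ge> 4" and t: "\<bar>t\<bar> \<le> real K / 4" for K t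
  proof -
    let ?s = "Complex \<sigma> t"
    let ?z = "?s / of_nat K"
    have s0: "?s \<noteq> 0" using \<sigma> by (auto simp: complex_eq_iff)
    have "norm ?s \<le> \<sigma> + \<bar>t\<bar>" using cmod_le[of ?s] \<sigma> by simp
    also have "\<dots> \<le> real K / 4 + real K / 4" using K \<sigma> t by (intro add_mono) auto
    finally have "norm ?z \<le> 1 / 2" using K by (simp add: norm_divide field_simps)
    from norm_one_minus_exp_ge[OF this]
    have "norm ?s \<le> 8 * real K * norm (1 - exp (- ?s / of_nat K))"
      using K by (simp add: norm_divide field_simps)
    then have "norm ?s * norm (riemann_zeta ?s)
        \<le> 8 * real K * norm (1 - exp (- ?s / of_nat K)) * norm (riemann_zeta ?s)"
      by (rule mult_right_mono) simp
    also have "\<dots> = norm ?s * (8 * real K * norm (fourier (\<phi> K) t))"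
      unfolding \<phi>_def using s0 \<sigma> by (subst fourier_frac_diff) (auto simp: norm_mult norm_divide)
    finally show ?thesis using s0 by (simp add: mult_le_cancel_left)
  qed
  \<comment> \<open>8 comes from the pointwise bound; 128 is 64 from (8 * K)^2 times the 2 in the
    constant 2 * pi * exp (1 / 2) of \<open>fourier_window_le\<close>.\<close>
  define C' where "C' = max (8 * C) (128 * pi * exp (1 / 2) * C)"
  have "C' > 0" using C by (simp add: C'_def less_max_iff_disj)
  moreover have "norm (riemann_zeta (Complex \<sigma> t)) \<le> C' * real K powr (1 - \<sigma>)"
    if K: "K \<ge> 4" and t: "\<bar>t\<bar> \<le> real K / 4" for K t
  proof -
    have "ennreal (LINT u|lborel. \<bar>\<phi> K u\<bar>) = (\<integral>\<^sup>+u. ennreal \<bar>\<phi> K u\<bar> \<partial>lborel)"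
      using int[of K] K by (intro nn_integral_eq_integral[symmetric]) auto
    also have "\<dots> \<le> ennreal (C * real K powr (- \<sigma>))" unfolding \<phi>_def using K by (intro C1) auto
    finally have "(LINT u|lborel. \<bar>\<phi> K u\<bar>) \<le> C * real K powr (- \<sigma>)"
      using C by (subst (asm) ennreal_le_iff) auto
    then have "norm (fourier (\<phi> K) t) \<le> C * real K powr (- \<sigma>)"
      using norm_fourier_le[OF int[of K], of t] K by linarith
    then have "8 * real K * norm (fourier (\<phi> K) t) \<le> 8 * real K * (C * real K powr (- \<sigma>))"
      by (rule mult_left_mono) simp
    also have "\<dots> = 8 * C * real K powr (1 - \<sigma>)"
      using K by (simp add: powr_diff powr_minus divide_inverse)
    also have "\<dots> \<le> C' * real K powr (1 - \<sigma>)" by (intro mult_right_mono) (auto simp: C'_def)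
    finally show ?thesis using zeta_le[OF K t] by linarith
  qed
  moreover have "(\<integral>\<^sup>+t. ennreal ((norm (riemann_zeta (Complex \<sigma> t)))\<^sup>2)
            * indicator {- (real K / 4)..real K / 4} t \<partial>lborel) \<le> ennreal (C' * real K)"
    if K: "K \<ge> 4" for K
  proof -
    have "(\<integral>\<^sup>+t. ennreal ((norm (riemann_zeta (Complex \<sigma> t)))\<^sup>2) * indicator {- (real K / 4)..real K / 4} t \<partial>lborel)
       \<le> (\<integral>\<^sup>+t. ennreal ((8 * real K)\<^sup>2) * (ennreal ((norm (fourier (\<phi> K) t))\<^sup>2) * indicator {- real K..real K} t) \<partial>lborel)"
    proof (rule nn_integral_mono)
      fix t
      show "ennreal ((norm (riemann_zeta (Complex \<sigma> t)))\<^sup>2) * indicator {- (real K / 4)..real K / 4} t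
        \<le> ennreal ((8 * real K)\<^sup>2) * (ennreal ((norm (fourier (\<phi> K) t))\<^sup>2) * indicator {- real K..real K} t)"
      proof (cases "\<bar>t\<bar> \<le> real K / 4")
        case True
        then have "t \<in> {- real K..real K}" "t \<in> {- (real K / 4)..real K / 4}" by auto
        moreover have "(norm (riemann_zeta (Complex \<sigma> t)))\<^sup>2 \<le> (8 * real K * norm (fourier (\<phi> K) t))\<^sup>2"
          using zeta_le[OF K True] by (rule power_mono) simp
        ultimately show ?thesis
          by (simp add: power_mult_distrib ennreal_leI flip: ennreal_mult')
      next
        case False
        then have "t \<notin> {- (real K / 4)..real K / 4}" by auto
        then show ?thesis by simp
      qed
    qed
    also have "\<dots> = ennreal ((8 * real K)\<^sup>2) * (\<integral>\<^sup>+t. ennreal ((norm (fourier (\<phi> K) t))\<^sup>2) * indicator {- real K..real K} t \<partial>lborel)"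
      by (rule nn_integral_cmult) measurable
    also have "\<dots> \<le> ennreal ((8 * real K)\<^sup>2) * (ennreal (2 * pi * exp (1 / 2)) * (\<integral>\<^sup>+u. ennreal ((\<phi> K u)\<^sup>2) \<partial>lborel))"
      using K by (intro mult_left_mono fourier_window_le int) auto
    also have "\<dots> \<le> ennreal ((8 * real K)\<^sup>2) * (ennreal (2 * pi * exp (1 / 2)) * ennreal (C / real K))"
      unfolding \<phi>_def using K by (intro mult_left_mono C2) auto
    also have "\<dots> = ennreal ((8 * real K)\<^sup>2 * (2 * pi * exp (1 / 2) * (C / real K)))"
    proof -
      have "0 \<le> 2 * pi * exp (1 / 2 :: real)" "0 \<le> C / real K" using C by simp_all
      then show ?thesis by (simp only: ennreal_mult zero_le_power2 mult_nonneg_nonneg)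
    qed
    also have "(8 * real K)\<^sup>2 * (2 * pi * exp (1 / 2) * (C / real K)) = 128 * pi * exp (1 / 2) * C * real K"
      using K by (simp add: power2_eq_square)
    also have "ennreal \<dots> \<le> ennreal (C' * real K)"
      by (intro ennreal_leI mult_right_mono) (auto simp: C'_def)
    finally show ?thesis .
  qed
  ultimately show ?thesis by blast
qed

section \<open>The fourth moment of zeta against the weight 1/(1 + y^2)\<close>

lemma zeta_line_measurable:
  assumes "\<sigma> \<noteq> 1"
  shows "(\<lambda>y. riemann_zeta (Complex \<sigma> y)) \<in> borel_measurable borel"
proof -
  have cont: "continuous_on (- {1}) riemann_zeta"
    using is_zeta_riemann_zeta by (auto simp: is_zeta_def intro: holomorphic_on_imp_continuous_on)
  have "Complex \<sigma> y \<in> - {1}" for y using assms by (auto simp: complex_eq_iff)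
  then have "range (Complex \<sigma>) \<subseteq> - {1}" by (rule image_subsetI)
  moreover have "continuous_on UNIV (Complex \<sigma>)"
    unfolding Complex_eq by (intro continuous_intros)
  ultimately have "continuous_on UNIV (\<lambda>y. riemann_zeta (Complex \<sigma> y))"
    by (intro continuous_on_compose2[OF cont])
  then show ?thesis by (rule borel_measurable_continuous_onI)
qed

text \<open>One factor \<open>|\<zeta>|\<^sup>2\<close> is bounded pointwise, the other in mean, over the dyadic windows
  \<open>|y| \<le> 2 ^ j\<close>.\<close>
lemma zeta_fourth_moment_finite:
  assumes \<sigma>: "1 / 2 < \<sigma>" "\<sigma> < 1"
  shows "(\<integral>\<^sup>+y. ennreal (norm (riemann_zeta (Complex \<sigma> y)) ^ 4 / (1 + y\<^sup>2)) \<partial>lborel) < \<infinity>"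
proof -
  let ?Z = "\<lambda>y. norm (riemann_zeta (Complex \<sigma> y))"
  \<comment> \<open>The factor 4 turns the window |t| \<le> K / 4 of \<open>zeta_bounds\<close> into
    |t| \<le> 2 ^ j.\<close>
  define K :: "nat \<Rightarrow> nat" where "K = (\<lambda>j. 4 * 2 ^ j)"
  have K4: "K j \<ge> 4" for j by (simp add: K_def)
  have rK: "real (K j) / 4 = 2 ^ j" for j by (simp add: K_def)
  obtain C where C: "C > 0" and C12: "\<forall>K\<ge>4.
      (\<forall>t. \<bar>t\<bar> \<le> real K / 4 \<longrightarrow> ?Z t \<le> C * real K powr (1 - \<sigma>)) \<and>
      (\<integral>\<^sup>+t. ennreal ((?Z t)\<^sup>2) * indicator {- (real K / 4)..real K / 4} t \<partial>lborel) \<le> ennreal (C * real K)"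
    using zeta_bounds[OF \<sigma>] by blast
  have C1: "?Z t \<le> C * real (K j) powr (1 - \<sigma>)" if "\<bar>t\<bar> \<le> 2 ^ j" for t j
    using C12 K4[of j] that unfolding rK[symmetric] by blast
  have C2: "(\<integral>\<^sup>+t. ennreal ((?Z t)\<^sup>2) * indicator {- (2 ^ j)..2 ^ j} t \<partial>lborel) \<le> ennreal (C * real (K j))" for j
    using C12 K4[of j] unfolding rK[symmetric] by blast
  have [measurable]: "(\<lambda>y. riemann_zeta (Complex \<sigma> y)) \<in> borel_measurable borel"
    using \<sigma> by (intro zeta_line_measurable) auto
  \<comment> \<open>The squared pointwise bound on window j, times the bound 4 / 4 ^ j for the
    weight outside window j - 1.\<close>
  define w where "w = (\<lambda>j. (C * real (K j) powr (1 - \<sigma>))\<^sup>2 * (4 / 4 ^ j))"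
  have w0: "w j \<ge> 0" for j by (simp add: w_def)
  have "ennreal (?Z y ^ 4 / (1 + y\<^sup>2)) \<le> (\<Sum>j. ennreal (w j) * (ennreal ((?Z y)\<^sup>2) * indicator {- (2 ^ j)..2 ^ j} y))" for y
  proof -
    \<comment> \<open>For the least window containing y, either j = 0 or |y| > 2 ^ (j - 1), so 1 +
      y^2 \<ge> 4 ^ j / 4. This single term of the series already dominates the integrand at
      y.\<close>
    define j where "j = (LEAST j. \<bar>y\<bar> \<le> 2 ^ j)"
    obtain m where "\<bar>y\<bar> < 2 ^ m" using real_arch_pow[of 2 "\<bar>y\<bar>"] by auto
    then have "\<bar>y\<bar> \<le> 2 ^ m" by simp
    then have j: "\<bar>y\<bar> \<le> 2 ^ j" unfolding j_def by (rule LeastI)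
    have y2: "4 ^ j / 4 \<le> 1 + y\<^sup>2"
    proof (cases j)
      case (Suc i)
      then have "\<not> \<bar>y\<bar> \<le> 2 ^ i" using not_less_Least[of i "\<lambda>j. \<bar>y\<bar> \<le> 2 ^ j"] by (simp add: j_def)
      then have "(2 ^ i)\<^sup>2 \<le> \<bar>y\<bar>\<^sup>2" by (intro power_mono) auto
      then show ?thesis by (simp add: Suc power2_eq_square flip: power_mult_distrib)
    qed simp
    have "?Z y ^ 4 / (1 + y\<^sup>2) = (?Z y)\<^sup>2 * (?Z y)\<^sup>2 * (1 / (1 + y\<^sup>2))" by (simp flip: power_add)
    also have "\<dots> \<le> (C * real (K j) powr (1 - \<sigma>))\<^sup>2 * (?Z y)\<^sup>2 * (4 / 4 ^ j)"
    proof (intro mult_mono)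
      have "0 < (4::real) ^ j / 4" by simp
      then have "inverse (1 + y\<^sup>2) \<le> inverse (4 ^ j / 4)" using y2 by (rule le_imp_inverse_le[rotated])
      then show "1 / (1 + y\<^sup>2) \<le> 4 / 4 ^ j" by (simp add: field_simps)
    qed (use C1[OF j] in \<open>auto intro: power_mono\<close>)
    also have "\<dots> = w j * (?Z y)\<^sup>2" by (simp add: w_def)
    finally have "ennreal (?Z y ^ 4 / (1 + y\<^sup>2)) \<le> ennreal (w j * (?Z y)\<^sup>2)" by (rule ennreal_leI)
    also have "\<dots> = ennreal (w j) * (ennreal ((?Z y)\<^sup>2) * indicator {- (2 ^ j)..2 ^ j} y)"
    proof -
      have "y \<in> {- (2 ^ j)..2 ^ j}" using j by (auto simp: abs_le_iff)
      then show ?thesis using w0 by (simp add: ennreal_mult)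
    qed
    also have "\<dots> \<le> (\<Sum>j. ennreal (w j) * (ennreal ((?Z y)\<^sup>2) * indicator {- (2 ^ j)..2 ^ j} y))"
      using sum_le_suminf[of "\<lambda>j. ennreal (w j) * (ennreal ((?Z y)\<^sup>2) * indicator {- (2 ^ j)..2 ^ j} y)" "{j}"]
      by simp
    finally show ?thesis .
  qed
  then have "(\<integral>\<^sup>+y. ennreal (?Z y ^ 4 / (1 + y\<^sup>2)) \<partial>lborel)
      \<le> (\<integral>\<^sup>+y. (\<Sum>j. ennreal (w j) * (ennreal ((?Z y)\<^sup>2) * indicator {- (2 ^ j)..2 ^ j} y)) \<partial>lborel)"
    by (rule nn_integral_mono)
  also have "\<dots> = (\<Sum>j. \<integral>\<^sup>+y. ennreal (w j) * (ennreal ((?Z y)\<^sup>2) * indicator {- (2 ^ j)..2 ^ j} y) \<partial>lborel)"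
    by (rule nn_integral_suminf) measurable
  also have "\<dots> = (\<Sum>j. ennreal (w j) * (\<integral>\<^sup>+y. ennreal ((?Z y)\<^sup>2) * indicator {- (2 ^ j)..2 ^ j} y \<partial>lborel))"
    by (subst nn_integral_cmult) auto
  also have "\<dots> \<le> (\<Sum>j. ennreal (w j) * ennreal (C * real (K j)))"
    by (intro suminf_le mult_left_mono C2) auto
  also have "\<dots> = (\<Sum>j. ennreal (w j * (C * real (K j))))"
    using w0 C by (simp add: ennreal_mult)
  also have "\<dots> < \<infinity>"
  proof -
    \<comment> \<open>Growth per dyadic step: the exponents 2 * (1 - \<sigma>), 1 and -2 from
      pointwise bound, mean square and weight add up to 1 - 2 * \<sigma>.\<close>
    define r where "r = 2 powr (1 - 2 * \<sigma>)"
    have r: "0 \<le> r" "r < 1" using \<sigma> by (auto simp: r_def powr_less_one)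
    have "w j * (C * real (K j)) = (16 * C ^ 3 * (4 powr (1 - \<sigma>))\<^sup>2) * r ^ j" for j
    proof -
      have a: "real (K j) powr (1 - \<sigma>) = 4 powr (1 - \<sigma>) * (2 powr (1 - \<sigma>)) ^ j"
        by (simp add: K_def powr_mult powr_power mult.commute flip: powr_realpow)
           (simp add: powr_powr mult.commute)
      have "r = 2 powr ((1 - \<sigma>) + (1 - \<sigma>) + 1 - 2)" by (simp add: r_def)
      also have "\<dots> = (2 powr (1 - \<sigma>))\<^sup>2 * 2 / 4" by (simp only: powr_add powr_diff power2_eq_square) simp
      finally have "r ^ j = ((2 powr (1 - \<sigma>)) ^ j)\<^sup>2 * 2 ^ j / 4 ^ j"
        by (simp only: power_mult_distrib power_divide power_mult[symmetric] mult.commute[of 2 j])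
      then show ?thesis unfolding w_def a by (simp add: K_def power_mult_distrib power2_eq_square power3_eq_cube)
    qed
    moreover have "summable (\<lambda>j. (16 * C ^ 3 * (4 powr (1 - \<sigma>))\<^sup>2) * r ^ j)"
      using r by (intro summable_mult summable_geometric) auto
    ultimately have "summable (\<lambda>j. w j * (C * real (K j)))" by (simp only:)
    then have "(\<Sum>j. ennreal (w j * (C * real (K j)))) = ennreal (\<Sum>j. w j * (C * real (K j)))"
      using w0 C by (intro suminf_ennreal2) auto
    then show ?thesis by simp
  qed
  finally show ?thesis .
qed

section \<open>The Cauchy measure and Boole's map\<close>

definition cauchy_dens :: "real \<Rightarrow> real \<Rightarrow> real \<Rightarrow> real" where
  "cauchy_dens \<alpha> \<beta> t = \<alpha> / pi * (1 / (\<alpha>\<^sup>2 + (t - \<beta>)\<^sup>2))"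

lemma cauchy_dens_measurable[measurable]: "cauchy_dens \<alpha> \<beta> \<in> borel_measurable borel"
  unfolding cauchy_dens_def by measurable

lemma cauchy_dens_nonneg: "\<alpha> \<ge> 0 \<Longrightarrow> cauchy_dens \<alpha> \<beta> t \<ge> 0"
  by (simp add: cauchy_dens_def)

text \<open>\<open>cauchy_measure\<close> lives on the Lebesgue sets. Its Borel version is the one
  to which the comparison of measures on half lines applies.\<close>

abbreviation std_cauchy :: "real measure" where
  "std_cauchy \<equiv> density lborel (\<lambda>t. ennreal (cauchy_dens 1 0 t))"

lemma cauchy_measure_eq: "cauchy_measure \<alpha> \<beta> = density lebesgue (\<lambda>t. ennreal (cauchy_dens \<alpha> \<beta> t))"
  by (simp add: cauchy_measure_def cauchy_dens_def)

lemma nn_integral_cauchy_measure: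
  assumes [measurable]: "g \<in> borel_measurable borel"
  shows "(\<integral>\<^sup>+x. g x \<partial>cauchy_measure 1 0) = (\<integral>\<^sup>+x. g x \<partial>std_cauchy)"
proof -
  have m: "(\<lambda>t. ennreal (cauchy_dens 1 0 t)) \<in> borel_measurable lborel" "g \<in> borel_measurable lborel"
    by measurable
  have "(\<integral>\<^sup>+x. g x \<partial>cauchy_measure 1 0) = (\<integral>\<^sup>+x. ennreal (cauchy_dens 1 0 x) * g x \<partial>lebesgue)"
    unfolding cauchy_measure_eq
    by (rule nn_integral_density) (use m in \<open>auto intro: measurable_completion\<close>)
  also have "\<dots> = (\<integral>\<^sup>+x. ennreal (cauchy_dens 1 0 x) * g x \<partial>lborel)"
    by (rule nn_integral_completion) measurable
  also have "\<dots> = (\<integral>\<^sup>+x. g x \<partial>std_cauchy)"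
    by (rule nn_integral_density[symmetric]) measurable
  finally show ?thesis .
qed

lemma emeasure_std_cauchy_greaterThan:
  "emeasure std_cauchy {x<..} = ennreal (1 / 2 - arctan x / pi)"
proof -
  have "AE t in lborel. t \<noteq> x" by (rule AE_lborel_singleton)
  then have "emeasure std_cauchy {x<..} = (\<integral>\<^sup>+t. ennreal (cauchy_dens 1 0 t) * indicator {x..} t \<partial>lborel)"
    by (subst emeasure_density, simp_all, intro nn_integral_cong_AE) (auto simp: indicator_def)
  also have "\<dots> = ennreal (1 / 2 - arctan x / pi)"
  proof (rule nn_integral_FTC_atLeast)
    have "((\<lambda>t. arctan t / pi) \<longlongrightarrow> (pi / 2) / pi) at_top"
      by (intro tendsto_intros tendsto_arctan_at_top) simp
    then show "((\<lambda>t. arctan t / pi) \<longlongrightarrow> 1 / 2) at_top" by simp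
    show "((\<lambda>t. arctan t / pi) has_real_derivative cauchy_dens 1 0 t) (at t)" for t
      unfolding cauchy_dens_def by (auto intro!: derivative_eq_intros simp: divide_inverse)
  qed (auto intro: cauchy_dens_nonneg)
  finally show ?thesis .
qed

text \<open>For p = tan \<theta> the argument on the left is - cot (2 * \<theta>) = tan (2 *
  \<theta> - pi / 2): Boole's map is angle doubling. Since p > 0, the new angle stays in the
  principal branch.\<close>

lemma arctan_boole_map:
  assumes "p > 0"
  shows "arctan ((p - 1 / p) / 2) = 2 * arctan p - pi / 2"
proof (rule arctan_unique)
  let ?\<theta> = "arctan p"
  show "- (pi / 2) < 2 * ?\<theta> - pi / 2" using assms by simp
  show "2 * ?\<theta> - pi / 2 < pi / 2" using arctan_ubound[of p] by simp
  have q: "1 + p\<^sup>2 > 0" by (simp add: add_pos_nonneg)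
  then have sq: "sqrt (1 + p\<^sup>2) * sqrt (1 + p\<^sup>2) = 1 + p\<^sup>2" by simp
  have s: "sin (2 * ?\<theta>) = 2 * p / (1 + p\<^sup>2)"
    unfolding sin_double sin_arctan cos_arctan using sq by (simp add: field_simps)
  have c: "cos (2 * ?\<theta>) = (1 - p\<^sup>2) / (1 + p\<^sup>2)"
    unfolding cos_double sin_arctan cos_arctan using q by (simp add: power_divide diff_divide_distrib)
  have "tan (2 * ?\<theta> - pi / 2) = - cos (2 * ?\<theta>) / sin (2 * ?\<theta>)"
    by (simp add: tan_def sin_diff cos_diff)
  also have "\<dots> = (p - 1 / p) / 2"
  proof -
    have "- ((1 - p\<^sup>2) / (1 + p\<^sup>2)) / (2 * p / (1 + p\<^sup>2)) = - (1 - p\<^sup>2) / (2 * p)"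
      using q by (simp add: divide_divide_eq_left)
    then show ?thesis unfolding s c using assms by (simp add: field_simps power2_eq_square)
  qed
  finally show "tan (2 * ?\<theta> - pi / 2) = (p - 1 / p) / 2" .
qed

lemma boole_map_measurable[measurable]: "boole_map \<in> borel_measurable borel"
  unfolding boole_map_def by measurable

text \<open>The value (p - 1 / p) / 2 is taken at p and at - 1 / p, once on each of the two
  increasing branches. The factorisation (x - p) * (x * p + 1) / (2 * x * p) of the difference
  reduces this to signs.\<close>

lemma boole_map_greater_iff:
  assumes "p > 0" "x \<noteq> 0"
  shows "boole_map x > (p - 1 / p) / 2 \<longleftrightarrow> (x < 0 \<and> - 1 / p < x) \<or> p < x"
proof -
  have eq: "boole_map x - (p - 1 / p) / 2 = (x - p) * (x * p + 1) / (2 * x * p)"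
    using assms by (simp add: boole_map_def field_simps)
  have bm: "boole_map x > (p - 1 / p) / 2 \<longleftrightarrow> 0 < (x - p) * (x * p + 1) / (2 * x * p)"
    unfolding eq[symmetric] by linarith
  show ?thesis
  proof (cases "x < 0")
    case True
    then have "x - p < 0" "2 * x * p < 0" using assms by (auto simp: mult_neg_pos)
    then have "0 < (x - p) * (x * p + 1) / (2 * x * p) \<longleftrightarrow> 0 < x * p + 1"
      using True assms by (auto simp: zero_less_divide_iff zero_less_mult_iff mult_less_0_iff)
    also have "\<dots> \<longleftrightarrow> - 1 / p < x" using assms by (simp add: field_simps) linarith
    finally show ?thesis unfolding bm using True assms by auto
  next
    case False
    then have x: "x > 0" using assms by simp
    then have "2 * x * p > 0" "x * p + 1 > 0" using assms by (auto intro: add_pos_pos)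
    then have "0 < (x - p) * (x * p + 1) / (2 * x * p) \<longleftrightarrow> 0 < x - p"
      using x assms by (auto simp: zero_less_divide_iff zero_less_mult_iff mult_less_0_iff)
    then show ?thesis unfolding bm using x by auto
  qed
qed

lemma distr_std_cauchy_boole_map: "distr std_cauchy borel boole_map = std_cauchy"
proof (rule measure_eqI_lessThan)
  have T[measurable]: "boole_map \<in> measurable std_cauchy borel" by simp
  show eq: "emeasure (distr std_cauchy borel boole_map) {a<..} = emeasure std_cauchy {a<..}" for a
  proof -
    \<comment> \<open>The positive solution of (p - 1 / p) / 2 = a.\<close>
    define p where "p = a + sqrt (a\<^sup>2 + 1)"
    have "sqrt (a\<^sup>2) < sqrt (a\<^sup>2 + 1)" by (rule real_sqrt_less_mono) simp
    then have "\<bar>a\<bar> < sqrt (a\<^sup>2 + 1)" by (simp only: real_sqrt_abs)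
    then have p: "p > 0" unfolding p_def by linarith
    have "(sqrt (a\<^sup>2 + 1))\<^sup>2 = a\<^sup>2 + 1" by simp
    then have "p * p - 1 = 2 * a * p" unfolding p_def by (simp add: power2_eq_square algebra_simps)
    then have a: "a = (p - 1 / p) / 2" using p by (simp add: field_simps)
    let ?P = "boole_map -` {a<..}"
    have P: "?P \<in> sets borel" using measurable_sets_borel[OF boole_map_measurable, of "{a<..}"] by simp
    have lt: "- 1 / p < 0" using p by simp
    \<comment> \<open>Up to a null set \<open>?P\<close> is the union of (- 1 / p, 0) and (p,
      infinity). Adding {0<..} turns it into a sum of two half lines, so the arctan formula applies
      without subtraction in ennreal; the finite summand 1 / 2 is cancelled at the end.\<close>
    have "emeasure std_cauchy ?P + emeasure std_cauchy {0<..}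
        = (\<integral>\<^sup>+x. indicator ?P x + indicator {0<..} x \<partial>std_cauchy)"
      using P by (subst nn_integral_add) auto
    also have "\<dots> = (\<integral>\<^sup>+x. indicator {- 1 / p<..} x + indicator {p<..} x \<partial>std_cauchy)"
    proof (rule nn_integral_cong_AE)
      have "AE x in lborel. x \<noteq> (0::real)" by (rule AE_lborel_singleton)
      then have "AE x in std_cauchy. x \<noteq> 0" by (subst AE_density) auto
      then show "AE x in std_cauchy. indicator ?P x + indicator {0<..} x
          = (indicator {- 1 / p<..} x + indicator {p<..} x :: ennreal)"
      proof eventually_elim
        case (elim x)
        define q where "q = - 1 / p"
        have "q < 0" using lt by (simp only: q_def)
        then show ?case
          using boole_map_greater_iff[OF p elim, folded a q_def] p elim unfolding q_def[symmetric]
          by (auto simp: indicator_def)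
      qed
    qed
    also have "\<dots> = emeasure std_cauchy {- 1 / p<..} + emeasure std_cauchy {p<..}"
      by (subst nn_integral_add) auto
    also have "\<dots> = ennreal (1 / 2 - arctan (- 1 / p) / pi + (1 / 2 - arctan p / pi))"
      unfolding emeasure_std_cauchy_greaterThan
      using arctan_ubound[of p] arctan_ubound[of "- 1 / p"] by (subst ennreal_plus) (auto simp: field_simps)
    also have "1 / 2 - arctan (- 1 / p) / pi + (1 / 2 - arctan p / pi) = (1 / 2 - arctan a / pi) + 1 / 2"
    proof -
      have e: "arctan (- 1 / p) = arctan p - pi / 2"
        using arctan_inverse[of p] p arctan_minus[of "1 / p"] by (simp add: inverse_eq_divide)
      show ?thesis unfolding e a arctan_boole_map[OF p] by (simp add: field_simps)
    qed
    also have "ennreal ((1 / 2 - arctan a / pi) + 1 / 2) = ennreal (1 / 2 - arctan a / pi) + ennreal (1 / 2)"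
      using arctan_ubound[of a] by (intro ennreal_plus) (auto simp: field_simps)
    finally have "emeasure std_cauchy ?P + ennreal (1 / 2) = emeasure std_cauchy {a<..} + ennreal (1 / 2)"
      unfolding emeasure_std_cauchy_greaterThan by simp
    then have "emeasure std_cauchy ?P = emeasure std_cauchy {a<..}"
      by (simp add: add.commute[of _ "ennreal (1 / 2)"] ennreal_add_left_cancel)
    then show ?thesis by (subst emeasure_distr) auto
  qed
  show "emeasure (distr std_cauchy borel boole_map) {x<..} < \<infinity>" for x
    unfolding eq emeasure_std_cauchy_greaterThan by simp
qed auto

lemma nn_integral_boole_map_iterate:
  assumes [measurable]: "g \<in> borel_measurable borel"
  shows "(\<integral>\<^sup>+x. g ((boole_map ^^ n) x) \<partial>std_cauchy) = (\<integral>\<^sup>+x. g x \<partial>std_cauchy)"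
proof (induction n)
  case (Suc n)
  have [measurable]: "(boole_map ^^ n) \<in> borel_measurable borel" for n
    by (induction n) (auto simp: o_def)
  have "(\<integral>\<^sup>+x. g ((boole_map ^^ n) (boole_map x)) \<partial>std_cauchy)
      = (\<integral>\<^sup>+x. g ((boole_map ^^ n) x) \<partial>distr std_cauchy borel boole_map)"
    by (rule nn_integral_distr[symmetric]) measurable
  then show ?case using Suc by (simp add: distr_std_cauchy_boole_map funpow_swap1)
qed simp

lemma emeasure_std_cauchy_UNIV_le: "emeasure std_cauchy UNIV \<le> ennreal 1"
proof -
  have "(\<Union>n. {- real n<..}) = UNIV"
  proof (intro equalityI subsetI)
    fix x :: real
    obtain n where "- x < real n" using reals_Archimedean2 by blast
    then show "x \<in> (\<Union>n. {- real n<..})" by (auto intro!: exI[of _ n])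
  qed simp
  moreover have "(SUP n. emeasure std_cauchy {- real n<..}) = emeasure std_cauchy (\<Union>n. {- real n<..})"
    by (intro SUP_emeasure_incseq) (auto simp: incseq_def)
  moreover have "emeasure std_cauchy {- real n<..} \<le> ennreal 1" for n
    unfolding emeasure_std_cauchy_greaterThan arctan_minus
    using arctan_ubound[of "real n"] by (intro ennreal_leI) (simp add: field_simps)
  ultimately show ?thesis by (metis SUP_least)
qed

text \<open>The ratio of the densities is bounded because 1 + t^2 \<le> 1 + 2 * \<beta>^2 + 2 * (t -
  \<beta>)^2. This transfers the weak type estimate from the invariant measure to all Cauchy
  measures.\<close>

lemma emeasure_cauchy_measure_le:
  assumes "\<alpha> > 0"
  shows "\<exists>c>0. \<forall>A. emeasure (cauchy_measure \<alpha> \<beta>) A \<le> ennreal c * emeasure (cauchy_measure 1 0) A"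
proof -
  define c where "c = \<alpha> * (2 + (1 + 2 * \<beta>\<^sup>2) / \<alpha>\<^sup>2)"
  have c: "c > 0" using assms by (auto simp: c_def intro!: mult_pos_pos add_pos_nonneg)
  have dens: "cauchy_dens \<alpha> \<beta> t \<le> c * cauchy_dens 1 0 t" for t
  proof -
    have "t\<^sup>2 \<le> 2 * \<beta>\<^sup>2 + 2 * (t - \<beta>)\<^sup>2"
      using zero_le_power2[of "t - 2 * \<beta>"] by (simp add: power2_diff algebra_simps)
    moreover have "(2 + (1 + 2 * \<beta>\<^sup>2) / \<alpha>\<^sup>2) * (\<alpha>\<^sup>2 + (t - \<beta>)\<^sup>2)
        = 2 * \<alpha>\<^sup>2 + 2 * (t - \<beta>)\<^sup>2 + (1 + 2 * \<beta>\<^sup>2) + (1 + 2 * \<beta>\<^sup>2) / \<alpha>\<^sup>2 * (t - \<beta>)\<^sup>2"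
      using assms by (simp add: field_simps)
    moreover have "0 \<le> (1 + 2 * \<beta>\<^sup>2) / \<alpha>\<^sup>2 * (t - \<beta>)\<^sup>2" "0 \<le> \<alpha>\<^sup>2" by simp_all
    ultimately have "1 + t\<^sup>2 \<le> (2 + (1 + 2 * \<beta>\<^sup>2) / \<alpha>\<^sup>2) * (\<alpha>\<^sup>2 + (t - \<beta>)\<^sup>2)" by linarith
    moreover have "1 + t\<^sup>2 > 0" "\<alpha>\<^sup>2 + (t - \<beta>)\<^sup>2 > 0" using assms by (simp_all add: add_pos_nonneg)
    ultimately have "1 / (\<alpha>\<^sup>2 + (t - \<beta>)\<^sup>2) \<le> (2 + (1 + 2 * \<beta>\<^sup>2) / \<alpha>\<^sup>2) * (1 / (1 + t\<^sup>2))"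
      by (simp add: pos_divide_le_eq pos_le_divide_eq mult.commute)
    then have "\<alpha> / pi * (1 / (\<alpha>\<^sup>2 + (t - \<beta>)\<^sup>2)) \<le> \<alpha> / pi * ((2 + (1 + 2 * \<beta>\<^sup>2) / \<alpha>\<^sup>2) * (1 / (1 + t\<^sup>2)))"
      using assms by (intro mult_left_mono) auto
    then show ?thesis by (simp add: cauchy_dens_def c_def)
  qed
  have m: "(\<lambda>t. ennreal (cauchy_dens \<alpha> \<beta> t)) \<in> borel_measurable lebesgue" for \<alpha> \<beta>
    by (rule measurable_completion) measurable
  have "emeasure (cauchy_measure \<alpha> \<beta>) A \<le> ennreal c * emeasure (cauchy_measure 1 0) A" for A
  proof (cases "A \<in> sets lebesgue")
    case True
    have "emeasure (cauchy_measure \<alpha> \<beta>) A = (\<integral>\<^sup>+t. ennreal (cauchy_dens \<alpha> \<beta> t) * indicator A t \<partial>lebesgue)"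
      unfolding cauchy_measure_eq by (rule emeasure_density[OF m True])
    also have "\<dots> \<le> (\<integral>\<^sup>+t. ennreal c * (ennreal (cauchy_dens 1 0 t) * indicator A t) \<partial>lebesgue)"
      using c dens by (intro nn_integral_mono)
        (auto simp: indicator_def cauchy_dens_nonneg ennreal_leI simp flip: ennreal_mult)
    also have "\<dots> = ennreal c * (\<integral>\<^sup>+t. ennreal (cauchy_dens 1 0 t) * indicator A t \<partial>lebesgue)"
      using m True by (intro nn_integral_cmult) auto
    also have "(\<integral>\<^sup>+t. ennreal (cauchy_dens 1 0 t) * indicator A t \<partial>lebesgue) = emeasure (cauchy_measure 1 0) A"
      unfolding cauchy_measure_eq by (rule emeasure_density[OF m True, symmetric])
    finally show ?thesis .
  next
    case False
    then have "A \<notin> sets (cauchy_measure \<alpha> \<beta>)" by (simp add: cauchy_measure_def)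
    then show ?thesis by (simp add: emeasure_notin_sets)
  qed
  with c show ?thesis by blast
qed

section \<open>The square function of the averages\<close>

text \<open>Cauchy-Schwarz twice, for the norms and then for their squares.\<close>

lemma norm_mean_power4_le:
  fixes z :: "nat \<Rightarrow> complex"
  assumes "M > 0"
  shows "norm ((\<Sum>n=1..M. z n) / of_nat M) ^ 4 \<le> (\<Sum>n=1..M. norm (z n) ^ 4) / real M"
proof -
  define S where "S = (\<Sum>n=1..M. norm (z n))"
  define S2 where "S2 = (\<Sum>n=1..M. (norm (z n))\<^sup>2)"
  define S4 where "S4 = (\<Sum>n=1..M. norm (z n) ^ 4)"
  have "S\<^sup>2 \<le> S2 * real M"
    unfolding S_def S2_def using sum_squared_le_sum_of_squares[of "\<lambda>n. norm (z n)" "{1..M}"] by simp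
  then have "(S\<^sup>2)\<^sup>2 \<le> (S2 * real M)\<^sup>2" by (rule power_mono) simp
  also have "\<dots> = S2\<^sup>2 * (real M)\<^sup>2" by (rule power_mult_distrib)
  also have "S2\<^sup>2 \<le> S4 * real M"
    unfolding S4_def S2_def using sum_squared_le_sum_of_squares[of "\<lambda>n. (norm (z n))\<^sup>2" "{1..M}"]
    by simp
  finally have "S ^ 4 \<le> S4 * real M * (real M)\<^sup>2" by (simp add: mult_right_mono)
  moreover have "norm (\<Sum>n=1..M. z n) \<le> S" unfolding S_def by (rule norm_sum)
  then have "norm (\<Sum>n=1..M. z n) ^ 4 \<le> S ^ 4" by (rule power_mono) simp
  ultimately have "norm (\<Sum>n=1..M. z n) ^ 4 \<le> S4 * real M ^ 3" by (simp add: power2_eq_square power3_eq_cube)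
  then have "norm (\<Sum>n=1..M. z n) ^ 4 / real M ^ 4 \<le> S4 * real M ^ 3 / real M ^ 4"
    by (rule divide_right_mono) simp
  also have "S4 * real M ^ 3 / real M ^ 4 = S4 / real M"
    using assms by (simp add: power_eq_if)
  finally show ?thesis by (simp add: S4_def norm_divide power_divide)
qed

lemma norm_diff_power4_le: "norm (x - y :: complex) ^ 4 \<le> 8 * (norm x ^ 4 + norm y ^ 4)"
proof -
  define a b where "a = norm x" and "b = norm y"
  have sq: "(u + v)\<^sup>2 \<le> 2 * (u\<^sup>2 + v\<^sup>2)" for u v :: real
    using zero_le_power2[of "u - v"] by (simp add: power2_diff power2_sum)
  have "norm (x - y) ^ 4 \<le> (a + b) ^ 4"
    unfolding a_def b_def by (intro power_mono norm_triangle_ineq4) simp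
  also have "\<dots> = ((a + b)\<^sup>2)\<^sup>2" by simp
  also have "\<dots> \<le> (2 * (a\<^sup>2 + b\<^sup>2))\<^sup>2" by (intro power_mono sq) simp
  also have "\<dots> = 4 * (a\<^sup>2 + b\<^sup>2)\<^sup>2" by (subst power_mult_distrib) simp
  also have "\<dots> \<le> 4 * (2 * ((a\<^sup>2)\<^sup>2 + (b\<^sup>2)\<^sup>2))" by (intro mult_left_mono sq) simp
  finally show ?thesis by (simp add: a_def b_def)
qed

lemma zeta_avg_diff:
  assumes "M > 0"
  shows "of_nat (Suc M) * (zeta_avg k s (Suc M) x - zeta_avg k s M x)
    = riemann_zeta (s + \<i> * of_real ((boole_map ^^ k (Suc M)) x)) - zeta_avg k s M x"
proof -
  have "(of_nat M :: complex) \<noteq> 0" "(of_nat (Suc M) :: complex) \<noteq> 0" using assms by (simp_all del: of_nat_Suc)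
  then show ?thesis unfolding zeta_avg_def by (simp add: divide_simps del: of_nat_Suc) (simp add: algebra_simps)
qed

text \<open>The shift by the ordinate t costs a bounded factor: 1 + (t + x)^2 \<le> (2 + 2 * t^2) *
  (1 + x^2).\<close>

lemma zeta_fourth_moment_cauchy_finite:
  assumes \<sigma>: "1 / 2 < \<sigma>" "\<sigma> < 1"
  shows "(\<integral>\<^sup>+x. ennreal (norm (riemann_zeta (Complex \<sigma> (t + x))) ^ 4) \<partial>std_cauchy) < \<infinity>"
proof -
  let ?Z = "\<lambda>y. norm (riemann_zeta (Complex \<sigma> y)) ^ 4"
  have [measurable]: "(\<lambda>y. riemann_zeta (Complex \<sigma> y)) \<in> borel_measurable borel"
    using \<sigma> by (intro zeta_line_measurable) auto
  have [measurable]: "(\<lambda>x. riemann_zeta (Complex \<sigma> (t + x))) \<in> borel_measurable borel"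
    by (rule measurable_compose[where f = "\<lambda>x. t + x" and g = "\<lambda>y. riemann_zeta (Complex \<sigma> y)"]) measurable
  define c where "c = 2 + 2 * t\<^sup>2"
  have c: "c \<ge> 0" by (simp add: c_def)
  have le: "cauchy_dens 1 0 x * ?Z (t + x) \<le> c * (?Z (t + x) / (1 + (t + x)\<^sup>2))" for x
  proof -
    have "(t + x)\<^sup>2 \<le> 2 * t\<^sup>2 + 2 * x\<^sup>2"
      using zero_le_power2[of "t - x"] by (simp add: power2_diff power2_sum)
    moreover have "t\<^sup>2 * x\<^sup>2 \<ge> 0" by simp
    moreover have "c * (1 + x\<^sup>2) = 2 + 2 * t\<^sup>2 + 2 * x\<^sup>2 + 2 * (t\<^sup>2 * x\<^sup>2)" by (simp add: c_def algebra_simps)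
    ultimately have "1 + (t + x)\<^sup>2 \<le> c * (1 + x\<^sup>2)" using zero_le_power2[of x] by linarith
    moreover have "1 + x\<^sup>2 > 0" "1 + (t + x)\<^sup>2 > 0" by (simp_all add: add_pos_nonneg)
    ultimately have *: "1 / (1 + x\<^sup>2) \<le> c / (1 + (t + x)\<^sup>2)" by (simp add: field_simps)
    have "1 / pi * (1 / (1 + x\<^sup>2)) \<le> 1 * (1 / (1 + x\<^sup>2))"
      using pi_ge_two by (intro mult_right_mono) auto
    then have "cauchy_dens 1 0 x \<le> c / (1 + (t + x)\<^sup>2)" using * by (simp add: cauchy_dens_def)
    then have "cauchy_dens 1 0 x * ?Z (t + x) \<le> c / (1 + (t + x)\<^sup>2) * ?Z (t + x)"
      by (rule mult_right_mono) simp
    then show ?thesis by simp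
  qed
  have "(\<integral>\<^sup>+x. ennreal (?Z (t + x)) \<partial>std_cauchy)
      = (\<integral>\<^sup>+x. ennreal (cauchy_dens 1 0 x) * ennreal (?Z (t + x)) \<partial>lborel)"
    by (rule nn_integral_density) measurable
  also have "\<dots> \<le> (\<integral>\<^sup>+x. ennreal c * ennreal (?Z (t + x) / (1 + (t + x)\<^sup>2)) \<partial>lborel)"
    using c le by (intro nn_integral_mono) (simp add: cauchy_dens_nonneg ennreal_leI flip: ennreal_mult)
  also have "\<dots> = ennreal c * (\<integral>\<^sup>+x. ennreal (?Z (t + x) / (1 + (t + x)\<^sup>2)) \<partial>lborel)"
    by (rule nn_integral_cmult) measurable
  also have "(\<integral>\<^sup>+x. ennreal (?Z (t + x) / (1 + (t + x)\<^sup>2)) \<partial>lborel) = (\<integral>\<^sup>+y. ennreal (?Z y / (1 + y\<^sup>2)) \<partial>lborel)"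
    using nn_integral_real_affine[of "\<lambda>y. ennreal (?Z y / (1 + y\<^sup>2))" 1 t] by simp
  also have "ennreal c * \<dots> < \<infinity>"
    using zeta_fourth_moment_finite[OF \<sigma>] by (simp add: ennreal_mult_less_top)
  finally show ?thesis .
qed

text \<open>Invariance gives every orbit term the same fourth moment A, and a mean of M such terms
  again has at most A. Neither k nor M enters the bound.\<close>

lemma zeta_avg_diff_fourth_moment:
  assumes s: "s = Complex \<sigma> t" and \<sigma>: "1 / 2 < \<sigma>" "\<sigma> < 1"
  shows "\<exists>B>0. \<forall>M>0. (\<integral>\<^sup>+x. ennreal ((real (Suc M) * norm (zeta_avg k s (Suc M) x - zeta_avg k s M x)) ^ 4)
    \<partial>cauchy_measure 1 0) \<le> ennreal B"
proof -
  define g where "g = (\<lambda>x. norm (riemann_zeta (Complex \<sigma> (t + x))) ^ 4)"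
  define f where "f = (\<lambda>n x. g ((boole_map ^^ k n) x))"
  have [measurable]: "(\<lambda>x. riemann_zeta (Complex \<sigma> (t + x))) \<in> borel_measurable borel"
    by (rule measurable_compose[where f = "\<lambda>x. t + x" and g = "\<lambda>y. riemann_zeta (Complex \<sigma> y)"])
       (use \<sigma> in \<open>auto intro: zeta_line_measurable\<close>)
  have g[measurable]: "g \<in> borel_measurable borel" unfolding g_def by measurable
  have [measurable]: "(boole_map ^^ n) \<in> borel_measurable borel" for n
    by (induction n) (auto simp: o_def)
  have f[measurable]: "f n \<in> borel_measurable borel" for n
    unfolding f_def by (rule measurable_compose[OF _ g]) measurable
  have f0: "f n x \<ge> 0" for n x by (simp add: f_def g_def)
  define A where "A = enn2real (\<integral>\<^sup>+x. ennreal (g x) \<partial>std_cauchy)"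
  have A: "A \<ge> 0" "(\<integral>\<^sup>+x. ennreal (g x) \<partial>std_cauchy) = ennreal A"
    using zeta_fourth_moment_cauchy_finite[OF \<sigma>, of t] unfolding A_def g_def by simp_all
  have intf: "(\<integral>\<^sup>+x. ennreal (f n x) \<partial>std_cauchy) = ennreal A" for n
    unfolding f_def using nn_integral_boole_map_iterate[of "\<lambda>x. ennreal (g x)" "k n"] A by simp
  have arg: "s + \<i> * complex_of_real y = Complex \<sigma> (t + y)" for y by (simp add: s complex_eq_iff)
  have "(\<integral>\<^sup>+x. ennreal ((real (Suc M) * norm (zeta_avg k s (Suc M) x - zeta_avg k s M x)) ^ 4) \<partial>cauchy_measure 1 0)
      \<le> ennreal (16 * A + 1)" if M: "M > 0" for M
  proof -
    define F where "F = (\<lambda>x. 8 * (f (Suc M) x + (\<Sum>n=1..M. f n x) / real M))"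
    have [measurable]: "F \<in> borel_measurable borel" unfolding F_def by measurable
    have le: "(real (Suc M) * norm (zeta_avg k s (Suc M) x - zeta_avg k s M x)) ^ 4 \<le> F x" for x
    proof -
      have "real (Suc M) * norm (zeta_avg k s (Suc M) x - zeta_avg k s M x)
          = norm (of_nat (Suc M) * (zeta_avg k s (Suc M) x - zeta_avg k s M x))"
        by (simp only: norm_mult norm_of_nat)
      then have "(real (Suc M) * norm (zeta_avg k s (Suc M) x - zeta_avg k s M x)) ^ 4
          \<le> 8 * (norm (riemann_zeta (s + \<i> * of_real ((boole_map ^^ k (Suc M)) x))) ^ 4 + norm (zeta_avg k s M x) ^ 4)"
        unfolding zeta_avg_diff[OF M] by (simp only: norm_diff_power4_le)
      also have "norm (zeta_avg k s M x) ^ 4 \<le> (\<Sum>n=1..M. f n x) / real M"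
        unfolding zeta_avg_def f_def g_def arg by (rule norm_mean_power4_le[OF M])
      also have "norm (riemann_zeta (s + \<i> * of_real ((boole_map ^^ k (Suc M)) x))) ^ 4 = f (Suc M) x"
        by (simp only: f_def g_def arg)
      finally show ?thesis by (simp add: F_def)
    qed
    have "(\<integral>\<^sup>+x. ennreal ((real (Suc M) * norm (zeta_avg k s (Suc M) x - zeta_avg k s M x)) ^ 4) \<partial>cauchy_measure 1 0)
        \<le> (\<integral>\<^sup>+x. ennreal (F x) \<partial>cauchy_measure 1 0)"
      by (intro nn_integral_mono ennreal_leI le)
    also have "\<dots> = (\<integral>\<^sup>+x. ennreal (F x) \<partial>std_cauchy)"
      by (rule nn_integral_cauchy_measure) measurable
    also have "\<dots> = (\<integral>\<^sup>+x. ennreal 8 * ennreal (f (Suc M) x) + (\<Sum>n=1..M. ennreal (8 / real M) * ennreal (f n x)) \<partial>std_cauchy)"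
    proof (rule nn_integral_cong)
      fix x
      have "F x = 8 * f (Suc M) x + (\<Sum>n=1..M. 8 / real M * f n x)"
        by (simp add: F_def distrib_left sum_distrib_left sum_divide_distrib)
      then show "ennreal (F x) = ennreal 8 * ennreal (f (Suc M) x) + (\<Sum>n=1..M. ennreal (8 / real M) * ennreal (f n x))"
      proof (simp only:, subst ennreal_plus)
        have "ennreal (\<Sum>n=1..M. 8 / real M * f n x) = (\<Sum>n=1..M. ennreal (8 / real M * f n x))"
          by (rule sum_ennreal[symmetric]) (simp add: f0)
        also have "\<dots> = (\<Sum>n=1..M. ennreal (8 / real M) * ennreal (f n x))"
          by (intro sum.cong ennreal_mult') auto
        finally show "ennreal (8 * f (Suc M) x) + ennreal (\<Sum>n=1..M. 8 / real M * f n x)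
            = ennreal 8 * ennreal (f (Suc M) x) + (\<Sum>n=1..M. ennreal (8 / real M) * ennreal (f n x))"
          by (simp only: ennreal_mult' zero_le_numeral)
      qed (auto intro!: sum_nonneg divide_nonneg_nonneg mult_nonneg_nonneg f0)
    qed
    also have "\<dots> = ennreal 8 * ennreal A + (\<Sum>n=1..M. ennreal (8 / real M) * ennreal A)"
      by (subst nn_integral_add) (simp_all add: nn_integral_cmult nn_integral_sum intf)
    also have "\<dots> = ennreal (16 * A)"
    proof -
      have 1: "ennreal 8 * ennreal A = ennreal (8 * A)" by (rule ennreal_mult'[symmetric]) simp
      have 2: "(\<Sum>n=1..M. ennreal (8 / real M) * ennreal A) = ennreal (8 * A)"
        using A M by (simp add: ennreal_of_nat_eq_real_of_nat flip: ennreal_mult')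
      have "ennreal (8 * A) + ennreal (8 * A) = ennreal (8 * A + 8 * A)"
        using A by (intro ennreal_plus[symmetric]) auto
      then show ?thesis unfolding 1 2 by simp
    qed
    also have "\<dots> \<le> ennreal (16 * A + 1)" by (intro ennreal_leI) simp
    finally show ?thesis .
  qed
  \<comment> \<open>16 * A is 8 * (A + A) from \<open>norm_diff_power4_le\<close>; the 1 makes the
    constant positive also if A = 0.\<close>
  then show ?thesis using A by (intro exI[of _ "16 * A + 1"]) auto
qed

text \<open>\<open>2 c b \<le> c\<^sup>2 + b\<^sup>2\<close> with \<open>c = l / W\<close> replaces the Cauchy--Schwarz inequality.\<close>
lemma weighted_sum_ge_imp:
  fixes w b :: "nat \<Rightarrow> real"
  assumes w: "\<And>n. w n \<ge> 0" and b: "\<And>n. b n \<ge> 0" and W: "w sums W" "W > 0" and l: "l > 0"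
    and ge: "ennreal l \<le> (\<Sum>n. ennreal (w n * b n))"
  shows "1 \<le> ennreal (W / l\<^sup>2) * (\<Sum>n. ennreal (w n * (b n)\<^sup>2))"
proof -
  define G where "G = (\<Sum>n. ennreal (w n * (b n)\<^sup>2))"
  \<comment> \<open>With c = l / W these are d = 1 / (2 * c) and e = c / 2. Then d * e = 1/4 gives b
    \<le> d * b^2 + e, and e * W = l / 2 is absorbed into the left side l.\<close>
  define d where "d = W / (2 * l)"
  define e where "e = l / (2 * W)"
  have de: "d > 0" "e > 0" using W l by (auto simp: d_def e_def)
  have "w n * b n \<le> d * (w n * (b n)\<^sup>2) + e * w n" for n
  proof -
    have "0 \<le> (sqrt d * b n - sqrt e)\<^sup>2" by simp
    also have "\<dots> = d * (b n)\<^sup>2 + e - 2 * (sqrt d * sqrt e) * b n"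
      using de by (simp add: power2_diff power_mult_distrib)
    also have "sqrt d * sqrt e = sqrt ((1 / 2)\<^sup>2)"
      unfolding real_sqrt_mult[symmetric] using W l by (simp add: d_def e_def power2_eq_square)
    finally have "b n \<le> d * (b n)\<^sup>2 + e" by simp
    from mult_left_mono[OF this w[of n]] show ?thesis by (simp add: algebra_simps)
  qed
  then have "ennreal (w n * b n) \<le> ennreal (d * (w n * (b n)\<^sup>2) + e * w n)" for n
    by (rule ennreal_leI)
  also have "ennreal (d * (w n * (b n)\<^sup>2) + e * w n) = ennreal d * ennreal (w n * (b n)\<^sup>2) + ennreal (e * w n)" for n
  proof -
    have "0 \<le> d * (w n * (b n)\<^sup>2)" "0 \<le> e * w n" using de w[of n] by simp_all
    then show ?thesis unfolding ennreal_mult'[OF less_imp_le[OF de(1)], symmetric] by (rule ennreal_plus)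
  qed
  finally have "(\<Sum>n. ennreal (w n * b n)) \<le> (\<Sum>n. ennreal d * ennreal (w n * (b n)\<^sup>2) + ennreal (e * w n))"
    by (intro suminf_le summableI)
  also have "\<dots> = ennreal d * G + (\<Sum>n. ennreal (e * w n))"
    unfolding G_def by (subst suminf_add[symmetric]) auto
  also have "(\<Sum>n. ennreal (e * w n)) = ennreal (e * W)"
    using W w de sums_unique[OF sums_mult[OF W(1), of e]] by (subst suminf_ennreal2) (auto intro!: summable_mult simp: sums_iff)
  also have "e * W = l / 2" using W by (simp add: e_def)
  finally have ineq: "ennreal l \<le> ennreal d * G + ennreal (l / 2)" using ge by (rule order_trans[rotated])
  show ?thesis
  proof (cases G)
    case (real g)
    then have "ennreal l \<le> ennreal (d * g + l / 2)" using ineq de l by (simp add: ennreal_mult' ennreal_plus)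
    then have "l \<le> d * g + l / 2" using real de l by (subst (asm) ennreal_le_iff) auto
    then have "1 \<le> W / l\<^sup>2 * g" using l unfolding d_def by (simp add: field_simps power2_eq_square)
    then have "ennreal 1 \<le> ennreal (W / l\<^sup>2 * g)" by (rule ennreal_leI)
    moreover have "0 \<le> W / l\<^sup>2" using W by simp
    ultimately show ?thesis
      unfolding G_def[symmetric] \<open>G = ennreal g\<close> by (simp only: ennreal_mult' ennreal_1)
  next
    case top
    then show ?thesis using W l unfolding G_def[symmetric] by (simp add: ennreal_mult_top)
  qed
qed

theorem theorem1p4:
  fixes s :: complex and \<sigma> t p :: real and k :: "nat \<Rightarrow> nat"
  assumes "s = Complex \<sigma> t" and "1 / 2 < \<sigma>" and "\<sigma> < 1"
    and "p > 2" and "Lp_good_universal p k"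
  shows
    "(\<exists>C::real. C > 0 \<and>
        (\<Sum>N. (L2_norm (cauchy_measure 1 0)
                 (\<lambda>x. zeta_avg k s (Suc N + 1) x - zeta_avg k s (Suc N) x))\<^sup>2)
        \<le> ennreal (C / (pi * \<sigma>) *
             norm (riemann_zeta (of_real (2 * \<sigma>)) / 2
                   + riemann_zeta (of_real (2 * \<sigma> - 1)) / of_real (2 * \<sigma> - 1)))) \<and>
     (\<forall>\<alpha> \<beta>::real. \<alpha> > 0 \<longrightarrow>
        (\<exists>C::real. C > 0 \<and>
          (\<forall>l::real. l > 0 \<longrightarrow>
            emeasure (cauchy_measure \<alpha> \<beta>)
              {x. (\<Sum>N. ennreal ((norm (zeta_avg k s (Suc N + 1) x - zeta_avg k s (Suc N) x))\<^sup>2))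
                    \<ge> ennreal l}
            \<le> ennreal (C / l\<^sup>2 *
                 norm (riemann_zeta (of_real (2 * \<sigma>)) / 2
                       + riemann_zeta (of_real (2 * \<sigma> - 1)) / of_real (2 * \<sigma> - 1))))))"
proof -
  define Q where "Q = norm (riemann_zeta (of_real (2 * \<sigma>)) / 2
                   + riemann_zeta (of_real (2 * \<sigma> - 1)) / of_real (2 * \<sigma> - 1))"
  have "riemann_zeta (of_real (2 * \<sigma>)) / 2 + riemann_zeta (of_real (2 * \<sigma> - 1)) / of_real (2 * \<sigma> - 1) \<noteq> 0"
    using zeta_combination_neg[OF assms(2,3)] by (metis less_irrefl zero_complex.sel(1))
  then have Q: "Q > 0" by (simp only: Q_def zero_less_norm_iff) simp
  define D where "D = (\<lambda>N x. norm (zeta_avg k s (Suc N + 1) x - zeta_avg k s (Suc N) x))"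
  \<comment> \<open>Index N stands for the difference of the averages of lengths N + 2 and N + 1,
    hence the weight 1 / (N + 2)^2. The rescaled square \<open>b\<close> has a second moment bounded
    uniformly in N.\<close>
  define w where "w = (\<lambda>N. 1 / (real (Suc (Suc N)))\<^sup>2)"
  define b where "b = (\<lambda>N x. (real (Suc (Suc N)) * D N x)\<^sup>2)"
  have w0: "w N > 0" for N by (simp add: w_def)
  have b0: "b N x \<ge> 0" for N x by (simp add: b_def)
  have D2: "(D N x)\<^sup>2 = w N * b N x" for N x
    by (simp add: w_def b_def power_mult_distrib del: of_nat_Suc)
  have "summable (\<lambda>n. inverse (real n ^ 2))" by (rule inverse_power_summable) simp
  then have sm: "summable w"
    unfolding w_def inverse_eq_divide by (subst summable_Suc_iff, subst summable_Suc_iff)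
  define W where "W = suminf w"
  have W: "w sums W" unfolding W_def using sm by (rule summable_sums)
  have W0: "W > 0" unfolding W_def using sm w0 by (intro suminf_pos)
  obtain B where B: "B > 0" and B4: "\<forall>M>0. (\<integral>\<^sup>+x. ennreal ((real (Suc M)
      * norm (zeta_avg k s (Suc M) x - zeta_avg k s M x)) ^ 4) \<partial>cauchy_measure 1 0) \<le> ennreal B"
    using zeta_avg_diff_fourth_moment[OF assms(1-3)] by blast
  have b2: "(\<integral>\<^sup>+x. ennreal ((b N x)\<^sup>2) \<partial>cauchy_measure 1 0) \<le> ennreal B" for N
    using B4[rule_format, of "Suc N"] by (simp add: b_def D_def flip: power_mult)
  have "Re s \<noteq> 1" using assms by simp
  note [measurable] = zeta_avg_measurable[OF this, of k]
  have [measurable]: "D N \<in> borel_measurable (cauchy_measure \<alpha> \<beta>)" for N \<alpha> \<beta>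
    unfolding D_def by measurable
  have [measurable]: "b N \<in> borel_measurable (cauchy_measure \<alpha> \<beta>)" for N \<alpha> \<beta>
    unfolding b_def by measurable
  have sumw: "(\<Sum>N. ennreal (w N * c)) = ennreal (W * c)" if "c \<ge> 0" for c
    using that w0 sums_mult2[OF W, of c] by (subst suminf_ennreal2) (auto simp: sums_iff less_imp_le)
  have space1: "emeasure (cauchy_measure 1 0) (space (cauchy_measure 1 0)) \<le> ennreal 1"
  proof -
    have "emeasure (cauchy_measure 1 0) (space (cauchy_measure 1 0)) = (\<integral>\<^sup>+x. 1 \<partial>cauchy_measure 1 0)" by simp
    also have "\<dots> = (\<integral>\<^sup>+x. 1 \<partial>std_cauchy)" by (rule nn_integral_cauchy_measure) simp
    also have "\<dots> = emeasure std_cauchy UNIV" by simp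
    also have "\<dots> \<le> ennreal 1" by (rule emeasure_std_cauchy_UNIV_le)
    finally show ?thesis .
  qed
  have 1: "(\<Sum>N. (L2_norm (cauchy_measure 1 0) (\<lambda>x. zeta_avg k s (Suc N + 1) x - zeta_avg k s (Suc N) x))\<^sup>2)
      \<le> ennreal (W * (1 + B))"
  proof -
    have "(\<integral>\<^sup>+x. ennreal ((D N x)\<^sup>2) \<partial>cauchy_measure 1 0) \<le> ennreal (w N * (1 + B))" for N
    proof -
      \<comment> \<open>b \<le> 1 + b^2 passes from the fourth moment back to the second; the term 1
        is harmless on a space of mass at most 1.\<close>
      have "(D N x)\<^sup>2 \<le> w N * (1 + (b N x)\<^sup>2)" for x
      proof -
        have "0 \<le> (b N x - 1)\<^sup>2" by simp
        then have "b N x \<le> 1 + (b N x)\<^sup>2" using b0[of N x] unfolding power2_diff by simp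
        then show ?thesis unfolding D2 using w0[of N] by (intro mult_left_mono) auto
      qed
      then have "(\<integral>\<^sup>+x. ennreal ((D N x)\<^sup>2) \<partial>cauchy_measure 1 0)
          \<le> (\<integral>\<^sup>+x. ennreal (w N) * (1 + ennreal ((b N x)\<^sup>2)) \<partial>cauchy_measure 1 0)"
        using w0[of N] by (intro nn_integral_mono)
          (auto intro!: ennreal_leI simp flip: ennreal_1 ennreal_plus ennreal_mult)
      also have "\<dots> = ennreal (w N) * (emeasure (cauchy_measure 1 0) (space (cauchy_measure 1 0))
          + (\<integral>\<^sup>+x. ennreal ((b N x)\<^sup>2) \<partial>cauchy_measure 1 0))"
        by (simp add: nn_integral_cmult nn_integral_add)
      also have "\<dots> \<le> ennreal (w N) * (ennreal 1 + ennreal B)"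
        by (intro mult_left_mono add_mono space1 b2) auto
      also have "\<dots> = ennreal (w N * (1 + B))"
        using w0[of N] B by (simp add: ennreal_mult ennreal_plus)
      finally show ?thesis .
    qed
    then have "(\<Sum>N. (L2_norm (cauchy_measure 1 0) (\<lambda>x. zeta_avg k s (Suc N + 1) x - zeta_avg k s (Suc N) x))\<^sup>2)
        \<le> (\<Sum>N. ennreal (w N * (1 + B)))"
      unfolding L2_norm_power2 D_def by (intro suminf_le) auto
    then show ?thesis using B by (simp add: sumw)
  qed
  have 2: "emeasure (cauchy_measure 1 0) {x. (\<Sum>N. ennreal ((D N x)\<^sup>2)) \<ge> ennreal l} \<le> ennreal (W\<^sup>2 * B / l\<^sup>2)"
    if l: "l > 0" for l
  proof -
    define G where "G = (\<lambda>x. \<Sum>N. ennreal (w N * (b N x)\<^sup>2))"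
    have [measurable]: "G \<in> borel_measurable (cauchy_measure 1 0)" unfolding G_def by measurable
    have sp: "space (cauchy_measure 1 0) = UNIV" by (simp add: cauchy_measure_def)
    have "(\<integral>\<^sup>+x. G x \<partial>cauchy_measure 1 0) = (\<Sum>N. \<integral>\<^sup>+x. ennreal (w N * (b N x)\<^sup>2) \<partial>cauchy_measure 1 0)"
      unfolding G_def by (rule nn_integral_suminf) measurable
    also have "\<dots> \<le> (\<Sum>N. ennreal (w N * B))"
    proof (intro suminf_le)
      fix N
      have "(\<integral>\<^sup>+x. ennreal (w N * (b N x)\<^sup>2) \<partial>cauchy_measure 1 0)
          = ennreal (w N) * (\<integral>\<^sup>+x. ennreal ((b N x)\<^sup>2) \<partial>cauchy_measure 1 0)"
        using w0[of N] by (subst nn_integral_cmult[symmetric]) (auto simp: ennreal_mult less_imp_le)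
      also have "\<dots> \<le> ennreal (w N) * ennreal B" by (intro mult_left_mono b2) auto
      also have "\<dots> = ennreal (w N * B)" using w0[of N] B by (simp add: ennreal_mult)
      finally show "(\<integral>\<^sup>+x. ennreal (w N * (b N x)\<^sup>2) \<partial>cauchy_measure 1 0) \<le> ennreal (w N * B)" .
    qed auto
    also have "\<dots> = ennreal (W * B)" using B by (intro sumw) simp
    finally have IG: "(\<integral>\<^sup>+x. G x \<partial>cauchy_measure 1 0) \<le> ennreal (W * B)" .
    \<comment> \<open>The superset is measurable, as \<open>emeasure_mono\<close> requires, and
      already has the form of Markov's inequality for \<open>G\<close>; the square of l enters
      here.\<close>
    have "{x. (\<Sum>N. ennreal ((D N x)\<^sup>2)) \<ge> ennreal l} \<subseteq> {x \<in> space (cauchy_measure 1 0). 1 \<le> ennreal (W / l\<^sup>2) * G x}"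
    proof
      fix x assume "x \<in> {x. (\<Sum>N. ennreal ((D N x)\<^sup>2)) \<ge> ennreal l}"
      then have "1 \<le> ennreal (W / l\<^sup>2) * G x"
        unfolding D2 G_def mem_Collect_eq by (rule weighted_sum_ge_imp[OF less_imp_le[OF w0] b0 W W0 l])
      then show "x \<in> {x \<in> space (cauchy_measure 1 0). 1 \<le> ennreal (W / l\<^sup>2) * G x}" by (simp add: sp)
    qed
    then have "emeasure (cauchy_measure 1 0) {x. (\<Sum>N. ennreal ((D N x)\<^sup>2)) \<ge> ennreal l}
        \<le> emeasure (cauchy_measure 1 0) {x \<in> space (cauchy_measure 1 0). 1 \<le> ennreal (W / l\<^sup>2) * G x}"
      by (rule emeasure_mono) measurable
    also have "\<dots> \<le> ennreal (W / l\<^sup>2) * (\<integral>\<^sup>+x. G x * indicator (space (cauchy_measure 1 0)) x \<partial>cauchy_measure 1 0)"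
      by (rule nn_integral_Markov_inequality) measurable
    also have "\<dots> = ennreal (W / l\<^sup>2) * (\<integral>\<^sup>+x. G x \<partial>cauchy_measure 1 0)"
      by (simp add: sp)
    also have "\<dots> \<le> ennreal (W / l\<^sup>2) * ennreal (W * B)"
      by (intro mult_left_mono IG) simp
    also have "\<dots> = ennreal (W\<^sup>2 * B / l\<^sup>2)"
      using W0 B by (simp add: power2_eq_square flip: ennreal_mult)
    finally show ?thesis .
  qed
  show ?thesis
  proof (intro conjI allI impI)
    \<comment> \<open>The factor pi * \<sigma> / Q undoes the prescribed shape of the right-hand
      side; Q > 0 comes from \<open>zeta_combination_neg\<close>.\<close>
    let ?C = "W * (1 + B) * (pi * \<sigma>) / Q"
    have "?C > 0" using W0 B Q assms by simp
    moreover have "?C / (pi * \<sigma>) * Q = W * (1 + B)" using Q assms by simp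
    ultimately show "\<exists>C>0. (\<Sum>N. (L2_norm (cauchy_measure 1 0)
                 (\<lambda>x. zeta_avg k s (Suc N + 1) x - zeta_avg k s (Suc N) x))\<^sup>2)
        \<le> ennreal (C / (pi * \<sigma>) *
             norm (riemann_zeta (of_real (2 * \<sigma>)) / 2
                   + riemann_zeta (of_real (2 * \<sigma> - 1)) / of_real (2 * \<sigma> - 1)))"
      unfolding Q_def[symmetric] using 1 by (intro exI[of _ ?C]) (simp only: simp_thms)
  next
    fix \<alpha> \<beta> :: real assume "\<alpha> > 0"
    then obtain c where c: "c > 0"
      and cle: "\<And>A. emeasure (cauchy_measure \<alpha> \<beta>) A \<le> ennreal c * emeasure (cauchy_measure 1 0) A"
      using emeasure_cauchy_measure_le by blast
    let ?C = "c * (W\<^sup>2 * B) / Q"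
    have "?C > 0" using W0 B Q c by simp
    moreover have "emeasure (cauchy_measure \<alpha> \<beta>) {x. (\<Sum>N. ennreal ((D N x)\<^sup>2)) \<ge> ennreal l} \<le> ennreal (?C / l\<^sup>2 * Q)"
      if l: "l > 0" for l
    proof -
      have "emeasure (cauchy_measure \<alpha> \<beta>) {x. (\<Sum>N. ennreal ((D N x)\<^sup>2)) \<ge> ennreal l}
          \<le> ennreal c * ennreal (W\<^sup>2 * B / l\<^sup>2)"
        by (intro order_trans[OF cle] mult_left_mono 2 l) auto
      also have "\<dots> = ennreal (?C / l\<^sup>2 * Q)" using c Q by (simp flip: ennreal_mult')
      finally show ?thesis .
    qed
    ultimately show "\<exists>C>0. \<forall>l>0.
            emeasure (cauchy_measure \<alpha> \<beta>)
              {x. (\<Sum>N. ennreal ((norm (zeta_avg k s (Suc N + 1) x - zeta_avg k s (Suc N) x))\<^sup>2))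
                    \<ge> ennreal l}
            \<le> ennreal (C / l\<^sup>2 *
                 norm (riemann_zeta (of_real (2 * \<sigma>)) / 2
                       + riemann_zeta (of_real (2 * \<sigma> - 1)) / of_real (2 * \<sigma> - 1)))"
      unfolding Q_def[symmetric] unfolding D_def by (intro exI[of _ ?C]) blast
  qed
qed

end
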